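(* Let $X_n=O((\xi_n,q_n))$, $n\ge 0$, be a sequence of $T$-periodic orbits with repetitive pattern, where $\xi_n\in\Sigma_k$ is generated by the finite word $\omega^n_1\dots\omega^n_{\pi_n}$. Then the sequence of projected measures $$\nu_n=\frac{1}{\pi_n}\sum_{\ell=0}^{\pi_n-1}\delta_{\sigma^{\ell}(\xi_n)}$$ converges in the weak-star topology to a $\sigma$-invariant and ergodic probability measure $\nu$ on $\Sigma_k$, with measure-theoretic entropy $h_{\nu}(\sigma)=0$.
   Context: Setting: fix $k\in\mathbb{N}$ and $C^1$ diffeomorphisms $f_1,\dots,f_k:\mathbb{S}^1\to\mathbb{S}^1$. Let $\Sigma_k=\{1,\dots,k\}^{\mathbb{Z}}$ with the product topology, $\sigma:\Sigma_k\to\Sigma_k$ the shift map, $M=\Sigma_k\times\mathbb{S}^1$, and let $T:M\to M$ be the locally constant skew product $T(\xi,x)=(\sigma(\xi),f_{\omega_0}(x))$ for $\xi=(\omega_j)_{j\in\mathbb{Z}}$. A point $\xi\in\Sigma_k$ is generated by a finite word $\omega_1\dots\omega_{\pi}$ if it is the bi-infinite periodic repetition of that word, positioned so that coordinate $j$ of $\xi$ is $\omega_{j+1}$ for $0\le j\le \pi-1$. $O(x)$ denotes the $T$-orbit of $x$. For an interval $J\subset\mathbb{S}^1$, $|J|$ is its length. Definition (repetitive pattern). A sequence $X_n=O((\xi_n,q_n))$, $n\ge 0$, of $T$-periodic orbits, where $\xi_n\in\Sigma_k$ is generated by the finite word $\omega^n_1\dots\omega^n_{\pi_n}$, has a repetitive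 pattern if: (1) There is a nested sequence of intervals $J_{n+1}\subset J_n\subset\mathbb{S}^1$ with $q_n\in J_n$, $0<|J_{n+1}|<|J_n|$ for every $n$, and $|J_n|\to 0$. (2) The intervals $J_0$ and $f_{\omega^0_\ell}\circ\dots\circ f_{\omega^0_1}(J_0)$, $\ell=1,\dots,\pi_0-1$, are pairwise disjoint. (3) For each $n\ge 0$, the map $g_n=f_{\omega^n_{\pi_n}}\circ\dots\circ f_{\omega^n_1}$ satisfies $g_n(q_n)=q_n$ and $|g_n'|<1$ on $J_n$. Moreover, for each $n\ge 1$ there exist an integer $R_n\ge1$, a map $T_{R_n}$ which is a composition of $R_n$ maps from $\{f_1,\dots,f_k\}$, and an integer $k_n\ge 2$ such that $g_n=T_{R_n}\circ g_{n-1}^{k_n}$. This equality is understood at the level of words: the word $\omega^n_1\dots\omega^n_{\pi_n}$ is $k_n$ consecutive copies of $\omega^{n-1}_1\dots\omega^{n-1}_{\pi_{n-1}}$ followed by a word $\alpha_n$ of length $R_n$ (the word defining $T_{R_n}$); in particular $\pi_n=k_n\pi_{n-1}+R_n$. (4) The sequence $\lambda_n=\frac{R_n}{k_n\pi_{n-1}}$, $n\ge1$, is summable. *)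

theory Defs
  imports "HOL-Probability.Probability"
begin

section \<open>The circle\<close>

abbreviation circle :: "complex set" where
  "circle \<equiv> sphere 0 1"

text \<open>Arcs of any kind (open, closed, half-open, degenerate) are allowed.\<close>

definition circle_interval :: "complex set \<Rightarrow> bool" where
  "circle_interval J \<longleftrightarrow> (\<exists>I. is_interval I \<and> J = cis ` I)"

definition arc_length :: "complex set \<Rightarrow> real" where
  "arc_length J = measure lborel {t \<in> {0..<2 * pi}. cis t \<in> J}"

text \<open>
  Smoothness is tested in the angular coordinate, along the covering map \<^const>\<open>cis\<close>.
\<close>

definition circle_C1 :: "(complex \<Rightarrow> complex) \<Rightarrow> bool" where
  "circle_C1 g \<longleftrightarrow> g ` circle \<subseteq> circle \<and> (\<lambda>t. g (cis t)) C1_differentiable_on UNIV"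

definition circle_C1_diffeo :: "(complex \<Rightarrow> complex) \<Rightarrow> bool" where
  "circle_C1_diffeo g \<longleftrightarrow>
     bij_betw g circle circle \<and> circle_C1 g \<and> circle_C1 (inv_into circle g)"

text \<open>
  The unit-speed curve \<open>x * cis t\<close> starts at \<open>x\<close>; its image under \<open>g\<close> has at time \<open>0\<close> a
  velocity that is a real multiple of the positive unit tangent vector \<open>\<i> * g x\<close> at \<open>g x\<close>.
  This factor is the derivative of \<open>g\<close> in the angular coordinates.
\<close>

definition circle_deriv :: "(complex \<Rightarrow> complex) \<Rightarrow> complex \<Rightarrow> real" where
  "circle_deriv g x = Re (vector_derivative (\<lambda>t. g (x * cis t)) (at 0) / (\<i> * g x))"

lemma circle_deriv_lift:
  assumes "\<And>s. cis (F s) = g (cis s)" and "(F has_real_derivative D) (at s)"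
  shows "circle_deriv g (cis s) = D"
proof -
  have "((\<lambda>t. F (s + t)) has_real_derivative D) (at 0)"
    using assms(2) DERIV_at_within_shift[of F D s 0 UNIV] by (simp add: add.commute)
  then have "((\<lambda>t. F (s + t)) has_derivative (\<lambda>t. t * D)) (at 0)"
    by (simp add: has_field_derivative_def mult_commute_abs)
  from has_derivative_cis[OF this]
  have "((\<lambda>t. cis (F (s + t))) has_vector_derivative (D *\<^sub>R (\<i> * cis (F s)))) (at 0)"
    by (simp add: has_vector_derivative_def)
  then have "vector_derivative (\<lambda>t. g (cis s * cis t)) (at 0) = D *\<^sub>R (\<i> * g (cis s))"
    by (simp add: cis_mult assms(1) vector_derivative_at)
  moreover have "g (cis s) \<noteq> 0"
    by (metis assms(1) cis_neq_zero)
  ultimately show ?thesis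
    by (simp add: circle_deriv_def scaleR_conv_of_real)
qed


section \<open>The full shift\<close>

text \<open>
  The type \<^typ>\<open>int \<Rightarrow> nat\<close> carries the product of the discrete topologies, so the product
  topology on \<open>Sigma_shift k\<close> is the induced one; see \<open>top_of_set_Sigma_shift\<close> below.
\<close>

definition Sigma_shift :: "nat \<Rightarrow> (int \<Rightarrow> nat) set" where
  "Sigma_shift k = {\<xi>. \<forall>j. \<xi> j \<in> {1..k}}"

definition Sigma_borel :: "nat \<Rightarrow> (int \<Rightarrow> nat) measure" where
  "Sigma_borel k = restrict_space borel (Sigma_shift k)"

definition shift_map :: "(int \<Rightarrow> nat) \<Rightarrow> (int \<Rightarrow> nat)" where
  "shift_map \<xi> = (\<lambda>j. \<xi> (j + 1))"

definition generated_by :: "(int \<Rightarrow> nat) \<Rightarrow> nat list \<Rightarrow> bool" where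
  "generated_by \<xi> w \<longleftrightarrow> w \<noteq> [] \<and> (\<forall>j. \<xi> j = w ! nat (j mod int (length w)))"

definition orbit_measure :: "nat \<Rightarrow> (int \<Rightarrow> nat) \<Rightarrow> nat \<Rightarrow> (int \<Rightarrow> nat) measure" where
  "orbit_measure k \<xi> p = measure_of (Sigma_shift k) (sets (Sigma_borel k))
     (\<lambda>A. (\<Sum>l<p. emeasure (return (Sigma_borel k) ((shift_map ^^ l) \<xi>)) A) / of_nat p)"

definition weak_star_converges ::
    "nat \<Rightarrow> (nat \<Rightarrow> (int \<Rightarrow> nat) measure) \<Rightarrow> (int \<Rightarrow> nat) measure \<Rightarrow> bool" where
  "weak_star_converges k \<mu> \<nu> \<longleftrightarrow>
     (\<forall>\<phi> :: (int \<Rightarrow> nat) \<Rightarrow> real. continuous_on (Sigma_shift k) \<phi> \<longrightarrow>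
        (\<lambda>n. \<integral>\<xi>. \<phi> \<xi> \<partial>\<mu> n) \<longlonglongrightarrow> (\<integral>\<xi>. \<phi> \<xi> \<partial>\<nu>))"

lemma top_of_set_Sigma_shift:
  "top_of_set (Sigma_shift k) = product_topology (\<lambda>_. discrete_topology {1..k}) UNIV"
proof -
  have *: "Sigma_shift k = PiE UNIV (\<lambda>_. {1..k})"
    by (auto simp: Sigma_shift_def)
  have "openin (top_of_set {1..k}) {x}" if "x \<in> {1..k}" for x
    unfolding openin_subtopology using that by (intro exI[of _ "{x}"])
      (auto intro: Topological_Spaces.open_discrete)
  then have "discrete_topology {1..k} = top_of_set {1..k}"
    by (subst discrete_topology_unique) simp
  then show ?thesis
    unfolding * by (simp add: subtopology_product_topology flip: euclidean_product_topology)
qed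

lemma shift_map_Sigma_shift: "\<xi> \<in> Sigma_shift k \<Longrightarrow> (shift_map ^^ l) \<xi> \<in> Sigma_shift k"
  by (induction l) (auto simp: Sigma_shift_def shift_map_def)

lemma space_Sigma_borel [simp]: "space (Sigma_borel k) = Sigma_shift k"
  by (simp add: Sigma_borel_def space_restrict_space)

lemma
  shows space_orbit_measure [simp]: "space (orbit_measure k \<xi> p) = Sigma_shift k"
    and sets_orbit_measure [simp]: "sets (orbit_measure k \<xi> p) = sets (Sigma_borel k)"
  using sets.sigma_algebra_axioms[of "Sigma_borel k"] sets.space_closed[of "Sigma_borel k"]
  by (auto simp: orbit_measure_def sigma_algebra.sigma_sets_eq)

lemma emeasure_orbit_measure:
  assumes "A \<in> sets (Sigma_borel k)"
  shows "emeasure (orbit_measure k \<xi> p) A = (\<Sum>l<p. indicator A ((shift_map ^^ l) \<xi>)) / of_nat p"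
proof -
  let ?f = "\<lambda>A. (\<Sum>l<p. emeasure (return (Sigma_borel k) ((shift_map ^^ l) \<xi>)) A) / of_nat p"
  have "countably_additive (sets (Sigma_borel k)) ?f"
  proof (rule countably_additiveI)
    fix B :: "nat \<Rightarrow> (int \<Rightarrow> nat) set"
    assume B: "range B \<subseteq> sets (Sigma_borel k)" "disjoint_family B"
    have "(\<Sum>i. ?f (B i)) = (\<Sum>i. \<Sum>l<p. emeasure (return (Sigma_borel k) ((shift_map ^^ l) \<xi>)) (B i)) / of_nat p"
      by (simp add: divide_ennreal_def)
    also have "\<dots> = ?f (\<Union>i. B i)"
      using B by (subst suminf_sum)
        (auto simp del: emeasure_return intro!: sum.cong arg_cong2[of _ _ _ _ "(/)"] suminf_emeasure)
    finally show "(\<Sum>i. ?f (B i)) = ?f (\<Union>i. B i)" .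
  qed
  moreover have "positive (sets (Sigma_borel k)) ?f"
    by (simp add: positive_def)
  ultimately have "emeasure (orbit_measure k \<xi> p) A = ?f A"
    using assms sets.sigma_algebra_axioms[of "Sigma_borel k"]
    unfolding orbit_measure_def by (intro emeasure_measure_of_sigma) simp_all
  with assms show ?thesis
    by (simp add: emeasure_return)
qed


section \<open>Ergodic theory\<close>

definition invariant_measure :: "'a measure \<Rightarrow> ('a \<Rightarrow> 'a) \<Rightarrow> bool" where
  "invariant_measure M T \<longleftrightarrow> T \<in> measurable M M \<and> distr M M T = M"

definition ergodic :: "'a measure \<Rightarrow> ('a \<Rightarrow> 'a) \<Rightarrow> bool" where
  "ergodic M T \<longleftrightarrow>
     (\<forall>A \<in> sets M. T -` A \<inter> space M = A \<longrightarrow> measure M A = 0 \<or> measure M A = 1)"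

definition measurable_partition :: "'a measure \<Rightarrow> 'a set set \<Rightarrow> bool" where
  "measurable_partition M P \<longleftrightarrow> finite P \<and> P \<subseteq> sets M \<and> partition_on (space M) P"

definition partition_entropy :: "'a measure \<Rightarrow> 'a set set \<Rightarrow> real" where
  "partition_entropy M P = - (\<Sum>A\<in>P. measure M A * ln (measure M A))"

text \<open>The nonempty cells of the join of the partitions \<open>(T ^^ i) -` P\<close> for \<open>i < n\<close>.\<close>

definition join_preimages ::
    "'a measure \<Rightarrow> ('a \<Rightarrow> 'a) \<Rightarrow> 'a set set \<Rightarrow> nat \<Rightarrow> 'a set set" where
  "join_preimages M T P n =
     {{x \<in> space M. \<forall>i<n. (T ^^ i) x \<in> F i} | F. \<forall>i<n. F i \<in> P} - {{}}"

definition entropy_wrt_partition :: "'a measure \<Rightarrow> ('a \<Rightarrow> 'a) \<Rightarrow> 'a set set \<Rightarrow> real" where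
  "entropy_wrt_partition M T P =
     lim (\<lambda>n. partition_entropy M (join_preimages M T P n) / real n)"

definition metric_entropy :: "'a measure \<Rightarrow> ('a \<Rightarrow> 'a) \<Rightarrow> ereal" where
  "metric_entropy M T =
     (SUP P \<in> {P. measurable_partition M P}. ereal (entropy_wrt_partition M T P))"


section \<open>The skew product and repetitive patterns\<close>

definition skew_product ::
    "(nat \<Rightarrow> complex \<Rightarrow> complex) \<Rightarrow> (int \<Rightarrow> nat) \<times> complex \<Rightarrow> (int \<Rightarrow> nat) \<times> complex" where
  "skew_product f = (\<lambda>(\<xi>, x). (shift_map \<xi>, f (\<xi> 0) x))"

text \<open>
  When the fibre maps are bijections of the circle, the skew product is a
  bijection of \<open>M = Sigma_shift k \<times> circle\<close>, and the two alternatives are the forward and the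
  backward half of the orbit.
\<close>

definition skew_orbit ::
    "nat \<Rightarrow> (nat \<Rightarrow> complex \<Rightarrow> complex) \<Rightarrow> (int \<Rightarrow> nat) \<times> complex \<Rightarrow> ((int \<Rightarrow> nat) \<times> complex) set" where
  "skew_orbit k f z = {y \<in> Sigma_shift k \<times> circle.
     \<exists>n. (skew_product f ^^ n) z = y \<or> (skew_product f ^^ n) y = z}"

definition periodic_point :: "('a \<Rightarrow> 'a) \<Rightarrow> 'a \<Rightarrow> bool" where
  "periodic_point T z \<longleftrightarrow> (\<exists>p>0. (T ^^ p) z = z)"

text \<open>
  For a word \<open>w = [w\<^sub>1, \<dots>, w\<^sub>m]\<close>, the map \<open>fold f w\<close> is the composition
  \<open>f w\<^sub>m \<circ> \<dots> \<circ> f w\<^sub>1\<close>. Below, \<open>K n\<close> is the repetition number and \<open>\<alpha> n\<close>, of length \<open>R n\<close>, the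
  appended word; only their values at \<open>n \<ge> 1\<close> matter.
\<close>

definition repetitive_pattern ::
    "nat \<Rightarrow> (nat \<Rightarrow> complex \<Rightarrow> complex) \<Rightarrow> (nat \<Rightarrow> complex) \<Rightarrow> (nat \<Rightarrow> nat list) \<Rightarrow> bool" where
  "repetitive_pattern k f q w \<longleftrightarrow>
     (\<exists>(J :: nat \<Rightarrow> complex set) (K :: nat \<Rightarrow> nat) (R :: nat \<Rightarrow> nat) (\<alpha> :: nat \<Rightarrow> nat list).
        (\<forall>n. circle_interval (J n) \<and> q n \<in> J n) \<and>
        (\<forall>n. J (Suc n) \<subseteq> J n \<and> 0 < arc_length (J (Suc n)) \<and>
             arc_length (J (Suc n)) < arc_length (J n)) \<and>
        (\<lambda>n. arc_length (J n)) \<longlonglongrightarrow> 0 \<and>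
        disjoint_family_on (\<lambda>l. fold f (take l (w 0)) ` J 0) {..<length (w 0)} \<and>
        (\<forall>n. fold f (w n) (q n) = q n \<and>
             (\<forall>x \<in> J n. \<bar>circle_deriv (fold f (w n)) x\<bar> < 1)) \<and>
        (\<forall>n\<ge>1. K n \<ge> 2 \<and> R n \<ge> 1 \<and> length (\<alpha> n) = R n \<and> set (\<alpha> n) \<subseteq> {1..k} \<and>
             w n = concat (replicate (K n) (w (n - 1))) @ \<alpha> n) \<and>
        summable (\<lambda>n. real (R (Suc n)) / (real (K (Suc n)) * real (length (w n)))))"

end

theory Submission
  imports Defs "HOL-Real_Asymp.Real_Asymp"
begin

text \<open>
  Fix \<open>n\<close> and put \<open>L = length (w n)\<close>. For \<open>N \<ge> n\<close> the word \<open>w N\<close> is a concatenation of copies of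
  \<open>w n\<close> and of spacers whose density is at most the tail of the summable series. Hence every
  window of length \<open>L\<close> in the periodic repetition of \<open>w N\<close> is a suffix of \<open>w n\<close>, then spacers, then
  a prefix of \<open>w n\<close>, and up to the spacers the suffix and the prefix together fill \<open>w n\<close> exactly
  once. On average over the windows, three things follow with an error tending to \<open>0\<close> as \<open>n\<close>
  grows, uniformly in \<open>N\<close>: the frequency of a cylinder in a window is its frequency in \<open>w n\<close>,
  so the orbit measures converge on cylinders and the limit is ergodic; and the window is, in
  Hamming distance, close to one of at most \<open>(L + 1)\<^sup>2\<close> reference words, so the entropy vanishes.
\<close>

section \<open>Criteria for ergodicity and zero entropy\<close>

text \<open>The split of a window into suffix, spacers and prefix comes from a labelling of the
  letters of \<open>w N\<close>. It depends on \<open>N\<close> and is not a function of the point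
  of the shift, so it has no meaning for the limit measure. It is replaced by
  \<open>glue_dist\<close>, the least number of mismatches over all splits \<open>(a, b)\<close>
  with \<open>a + b \<le> L\<close>. This function reads finitely many coordinates, hence is
  continuous, and its mean under the \<open>N\<close>-th orbit measure is at most
  \<open>L * err n + 4 * m\<close> for every \<open>N \<ge> n\<close>, so the bound passes to the
  weak limit. All three conclusions rest on this number: it controls the deviation of window
  frequencies from those in \<open>w n\<close>, and it counts the positions at which a window
  differs from a reference word. The frequencies in \<open>w n\<close> come out exactly because the
  positions of a window are matched with those of \<open>w n\<close> by a permutation, the spacers
  being sent to the positions that neither piece covers. Division by \<open>L\<close> leaves
  \<open>err n + 4 * m / L\<close>, which tends to 0 for fixed \<open>m\<close>.\<close>

lemma invariant_measure_funpow:
  assumes "invariant_measure M T"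
  shows "T ^^ n \<in> measurable M M" and "distr M M (T ^^ n) = M"
proof (induction n)
  case 0
  { case 1 show ?case by simp
  next case 2 show ?case by (simp add: id_def) }
next
  case (Suc n)
  have T: "T \<in> measurable M M" "distr M M T = M" using assms by (auto simp: invariant_measure_def)
  have eq: "T ^^ Suc n = (\<lambda>x. T ((T ^^ n) x))" by auto
  { case 1 show ?case unfolding eq using T Suc by measurable
  next case 2
    have "distr M M (\<lambda>x. T ((T ^^ n) x)) = distr (distr M M (T ^^ n)) M T"
      using T Suc by (subst distr_distr) (simp_all add: comp_def)
    then show ?case unfolding eq using T Suc by simp }
qed

lemma measure_invariant_vimage:
  assumes "invariant_measure M T" "A \<in> sets M"
  shows "measure M ((T ^^ n) -` A \<inter> space M) = measure M A"
  using measure_distr[OF invariant_measure_funpow(1)[OF assms(1), of n] assms(2)]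
    invariant_measure_funpow(2)[OF assms(1), of n] by simp

text \<open>
  For an invariant set \<open>A\<close> the correlation \<open>measure M (A \<inter> C)\<close> equals the integral over \<open>A\<close> of
  the ergodic averages of \<open>C\<close>, so that \<open>A\<close> is independent of the generator and hence of itself.
\<close>

lemma ergodicI_averages:
  assumes "prob_space M" and inv: "invariant_measure M T"
    and G: "Int_stable G" "G \<subseteq> Pow (space M)" "sets M = sigma_sets (space M) G"
    and avg: "\<And>C e. C \<in> G \<Longrightarrow> e > 0 \<Longrightarrow>
      \<exists>n>0. (\<integral>x. \<bar>(\<Sum>i<n. indicator C ((T ^^ i) x)) / real n - measure M C\<bar> \<partial>M) \<le> e"
  shows "ergodic M T"
  unfolding ergodic_def
proof (intro ballI impI)
  fix A assume A: "A \<in> sets M" and TA: "T -` A \<inter> space M = A"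
  interpret prob_space M by fact
  have Tn[measurable]: "T ^^ n \<in> measurable M M" for n
    using invariant_measure_funpow[OF inv] by blast
  have TAn: "(T ^^ n) -` A \<inter> space M = A" for n
  proof (induction n)
    case 0 then show ?case using sets.sets_into_space[OF A] by auto
  next
    case (Suc n)
    have "(T ^^ Suc n) -` A \<inter> space M = (T ^^ n) -` (T -` A \<inter> space M) \<inter> space M"
      using measurable_space[OF Tn[of n]] by auto
    also have "\<dots> = A" by (simp only: TA Suc)
    finally show ?case .
  qed
  have *: "measure M (A \<inter> C) = measure M A * measure M C" if C: "C \<in> G" for C
  proof -
    have CM[measurable]: "C \<in> sets M" using C G by auto
    have "\<bar>measure M (A \<inter> C) - measure M A * measure M C\<bar> \<le> e" if "e > 0" for e
    proof -
      obtain n where n: "n > 0"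
        "(\<integral>x. \<bar>(\<Sum>i<n. indicator C ((T ^^ i) x)) / real n - measure M C\<bar> \<partial>M) \<le> e"
        using avg[OF C \<open>e > 0\<close>] by blast
      let ?a = "\<lambda>x. (\<Sum>i<n. indicator C ((T ^^ i) x)) / real n - measure M C :: real"
      have ind: "indicator C ((T ^^ i) x) = indicat_real ((T ^^ i) -` C \<inter> space M) x"
        if "x \<in> space M" for i x using that by (auto simp: indicator_def)
      have m: "(T ^^ i) -` C \<inter> space M \<in> sets M" for i by measurable
      have int_a: "integrable M ?a"
        by (subst Bochner_Integration.integrable_cong[OF refl, where g="\<lambda>x. (\<Sum>i<n. indicat_real ((T ^^ i) -` C \<inter> space M) x) / real n - measure M C"])
          (auto simp: ind intro!: integrable_real_indicator m emeasure_finite simp: less_top[symmetric])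
      \<comment> \<open>Since \<open>A\<close> is its own preimage under \<open>T ^^ i\<close>, the
        product is the indicator of the preimage of \<open>A \<inter> C\<close>, and invariance
        applies.\<close>
      have corr: "(\<integral>x. indicator A x * indicator C ((T ^^ i) x) \<partial>M) = measure M (A \<inter> C)" for i
      proof -
        have "(\<integral>x. indicator A x * indicator C ((T ^^ i) x) \<partial>M)
            = (\<integral>x. indicat_real ((T ^^ i) -` (A \<inter> C) \<inter> space M) x \<partial>M)"
          using TAn[of i] by (intro Bochner_Integration.integral_cong refl) (auto simp: indicator_def)
        then show ?thesis
          using measure_invariant_vimage[OF inv, of "A \<inter> C" i] A CM by simp
      qed
      have intAC: "integrable M (\<lambda>x. indicator A x * indicat_real C ((T ^^ i) x))" for i
        using A CM by (intro integrable_const_bound[where B=1]) (auto simp: indicator_def)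
      \<comment> \<open>By \<open>corr\<close> all \<open>n\<close> terms have the same integral
        over \<open>A\<close>, so integrating the deviation over \<open>A\<close> gives exactly the
        defect of independence; its absolute value is at most the mean absolute deviation.\<close>
      have "(\<integral>x. indicator A x * ?a x \<partial>M)
          = (\<integral>x. (\<Sum>i<n. indicator A x * indicator C ((T ^^ i) x)) / real n - measure M C * indicator A x \<partial>M)"
        by (intro Bochner_Integration.integral_cong refl) (simp add: sum_distrib_left algebra_simps)
      also have "\<dots> = (\<Sum>i<n. measure M (A \<inter> C)) / real n - measure M C * measure M A"
      proof -
        have "integrable M (\<lambda>x. (\<Sum>i<n. indicator A x * indicat_real C ((T ^^ i) x)) / real n)"
          by (intro integrable_divide Bochner_Integration.integrable_sum intAC)
        moreover have "integrable M (\<lambda>x. measure M C * indicat_real A x)"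
          using A by (intro integrable_mult_right integrable_real_indicator) (auto simp: less_top[symmetric])
        moreover have "(\<integral>x. (\<Sum>i<n. indicator A x * indicat_real C ((T ^^ i) x)) \<partial>M) = (\<Sum>i<n. \<integral>x. indicator A x * indicat_real C ((T ^^ i) x) \<partial>M)"
          by (rule Bochner_Integration.integral_sum) (rule intAC)
        moreover have "(\<integral>x. indicat_real A x \<partial>M) = measure M A"
          using A by simp
        ultimately show ?thesis
          by (simp only: corr Bochner_Integration.integral_diff integral_divide_zero integral_mult_right_zero)
      qed
      also have "\<dots> = measure M (A \<inter> C) - measure M A * measure M C"
        using n by simp
      finally have "\<bar>measure M (A \<inter> C) - measure M A * measure M C\<bar> = \<bar>\<integral>x. indicator A x * ?a x \<partial>M\<bar>"
        by simp
      also have "\<dots> \<le> (\<integral>x. \<bar>indicator A x * ?a x\<bar> \<partial>M)"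
        by (rule integral_abs_bound)
      also have "\<dots> \<le> (\<integral>x. \<bar>?a x\<bar> \<partial>M)"
        using int_a A by (intro integral_mono integrable_abs)
          (auto simp: abs_mult indicator_def intro: integrable_mult_indicator[where 'b=real, simplified])
      finally show ?thesis using n by simp
    qed
    then have "\<bar>measure M (A \<inter> C) - measure M A * measure M C\<bar> \<le> 0"
      by (rule field_le_epsilon) simp
    then show ?thesis by simp
  qed
  have "measure M (A \<inter> B) = measure M A * measure M B" if "B \<in> sigma_sets (space M) G" for B
    using G(1,2) that
  proof (induction rule: sigma_sets_induct_disjoint)
    case (basic B) then show ?case using * by blast
  next
    case empty then show ?case by simp
  next
    case (compl B)
    then have B: "B \<in> sets M" using G by simp
    have "measure M (A \<inter> (space M - B)) = measure M (A - A \<inter> B)"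
      using sets.sets_into_space[OF A] by (intro arg_cong[where f="measure M"]) auto
    also have "\<dots> = measure M A - measure M (A \<inter> B)"
      using A B by (intro finite_measure_Diff) auto
    finally show ?case using compl B by (simp add: prob_compl algebra_simps)
  next
    case (union B)
    then have B: "range B \<subseteq> sets M" using G by simp
    have "(\<lambda>i. measure M (A \<inter> B i)) sums measure M (\<Union>i. A \<inter> B i)"
      using A B union(1) by (intro finite_measure_UNION) (auto simp: disjoint_family_on_def)
    moreover have "(\<lambda>i. measure M A * measure M (B i)) sums (measure M A * measure M (\<Union>i. B i))"
      using B union(1) by (intro sums_mult finite_measure_UNION) auto
    ultimately show ?case using union(3) sums_unique2 by (simp flip: Int_UN_distrib)
  qed
  from this[of A] A G have "measure M A * measure M A = measure M A" by simp
  then show "measure M A = 0 \<or> measure M A = 1" by simp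
qed

section \<open>Itineraries and the entropy of refined partitions\<close>

definition cell_of :: "'a set set \<Rightarrow> 'a \<Rightarrow> 'a set" where
  "cell_of P x = (THE A. A \<in> P \<and> x \<in> A)"

text \<open>Restricted to \<open>{..<n}\<close> so that the values lie in the finite set
  \<open>PiE {..<n} (\<lambda>_. P)\<close> and equality of itineraries means equality below
  \<open>n\<close> only.\<close>

definition itinerary :: "('a \<Rightarrow> 'a) \<Rightarrow> 'a set set \<Rightarrow> nat \<Rightarrow> 'a \<Rightarrow> nat \<Rightarrow> 'a set" where
  "itinerary T P n x = (\<lambda>i\<in>{..<n}. cell_of P ((T ^^ i) x))"

lemma cell_of_eq:
  assumes "partition_on S P" "A \<in> P" "x \<in> A"
  shows "cell_of P x = A"
  unfolding cell_of_def using assms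
  by (intro the_equality) (auto simp: partition_on_def disjoint_def)

lemma cell_of_mem:
  assumes "partition_on S P" "x \<in> S"
  shows "cell_of P x \<in> P" "x \<in> cell_of P x"
proof -
  obtain A where "A \<in> P" "x \<in> A" using assms by (auto simp: partition_on_def)
  then show "cell_of P x \<in> P" "x \<in> cell_of P x" using cell_of_eq[OF assms(1)] by auto
qed

lemma cell_of_eq_iff:
  assumes "partition_on S P" "A \<in> P" "x \<in> S"
  shows "cell_of P x = A \<longleftrightarrow> x \<in> A"
  using cell_of_mem[OF assms(1,3)] cell_of_eq[OF assms(1,2)] by auto

lemma (in prob_space) integral_simple_comp:
  fixes g :: "'b \<Rightarrow> real"
  assumes X: "simple_function M X"
  shows "(\<integral>x. g (X x) \<partial>M) = (\<Sum>v\<in>X ` space M. prob (X -` {v} \<inter> space M) * g v)"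
    and "integrable M (\<lambda>x. g (X x))"
proof -
  have fin: "finite (X ` space M)" and m: "X -` {v} \<inter> space M \<in> sets M" for v
    using X by (auto simp: simple_function_def intro: simple_functionD)
  have eq: "g (X x) = (\<Sum>v\<in>X ` space M. indicator (X -` {v} \<inter> space M) x * g v)" if "x \<in> space M" for x
  proof -
    have "(\<Sum>v\<in>X ` space M. indicator (X -` {v} \<inter> space M) x * g v) = (\<Sum>v\<in>{X x}. indicator (X -` {v} \<inter> space M) x * g v)"
      using that fin by (intro sum.mono_neutral_right) (auto simp: indicator_def)
    then show ?thesis using that by simp
  qed
  have int: "integrable M (\<lambda>x. indicator (X -` {v} \<inter> space M) x * g v)" for v
    using m by (intro integrable_mult_left integrable_real_indicator) (auto simp: less_top[symmetric])
  show "integrable M (\<lambda>x. g (X x))"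
    by (subst Bochner_Integration.integrable_cong[OF refl eq]) (auto intro: int)
  show "(\<integral>x. g (X x) \<partial>M) = (\<Sum>v\<in>X ` space M. prob (X -` {v} \<inter> space M) * g v)"
  proof -
    have "(\<integral>x. g (X x) \<partial>M) = (\<integral>x. (\<Sum>v\<in>X ` space M. indicator (X -` {v} \<inter> space M) x * g v) \<partial>M)"
      by (rule Bochner_Integration.integral_cong[OF refl eq])
    also have "\<dots> = (\<Sum>v\<in>X ` space M. \<integral>x. indicator (X -` {v} \<inter> space M) x * g v \<partial>M)"
      by (rule Bochner_Integration.integral_sum) (rule int)
    finally show ?thesis using m by simp
  qed
qed

context prob_space
begin

text \<open>Base \<open>exp 1\<close> turns \<open>log\<close> into the \<open>ln\<close> used in
  \<open>partition_entropy\<close>.\<close>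

interpretation I: information_space M "exp 1"
  by unfold_locales simp

abbreviation shannon_entropy :: "('a \<Rightarrow> 'b) \<Rightarrow> real" where
  "shannon_entropy X \<equiv> entropy (exp 1) (count_space (X ` space M)) X"

text \<open>Values outside the range have an empty fibre and contribute 0. The freedom in
  \<open>V\<close> allows two variables to be compared over a common index set.\<close>

lemma shannon_entropy_eq_sum:
  assumes X: "simple_function M X" and V: "finite V" "X ` space M \<subseteq> V"
  shows "shannon_entropy X = - (\<Sum>v\<in>V. prob (X -` {v} \<inter> space M) * ln (prob (X -` {v} \<inter> space M)))"
proof -
  have "shannon_entropy X = - (\<Sum>v\<in>X ` space M. prob (X -` {v} \<inter> space M) * ln (prob (X -` {v} \<inter> space M)))"
    by (subst I.entropy_simple_distributed[OF simple_distributedI[OF X measure_nonneg refl]]) (simp add: log_def)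
  also have "(\<Sum>v\<in>X ` space M. prob (X -` {v} \<inter> space M) * ln (prob (X -` {v} \<inter> space M)))
    = (\<Sum>v\<in>V. prob (X -` {v} \<inter> space M) * ln (prob (X -` {v} \<inter> space M)))"
  proof (intro sum.mono_neutral_left V ballI)
    fix v assume "v \<in> V - X ` space M"
    then have "X -` {v} \<inter> space M = {}" by auto
    then show "prob (X -` {v} \<inter> space M) * ln (prob (X -` {v} \<inter> space M)) = 0" by simp
  qed
  finally show ?thesis .
qed

lemma shannon_entropy_pair_le:
  assumes "simple_function M X" "simple_function M Y"
  shows "shannon_entropy (\<lambda>x. (X x, Y x)) \<le> shannon_entropy X + shannon_entropy Y"
  using I.entropy_chain_rule[OF assms] I.conditional_entropy_less_eq_entropy[OF assms(2,1)] by simp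

lemma shannon_entropy_comp_le:
  assumes "simple_function M X"
  shows "shannon_entropy (f \<circ> X) \<le> shannon_entropy X"
  by (rule I.entropy_data_processing[OF assms])

text \<open>Cross entropy dominates entropy, by \<open>ln t \<le> t - 1\<close> at
  \<open>t = r v / p v\<close>. A total mass of at most 1 is enough for \<open>r\<close>; the
  mixture to which this is applied is only known to satisfy that.\<close>

lemma gibbs_inequality:
  assumes X: "simple_function M X"
    and r: "\<And>v. v \<in> X ` space M \<Longrightarrow> r v > 0" "(\<Sum>v\<in>X ` space M. r v) \<le> 1"
  shows "shannon_entropy X \<le> (\<integral>x. - ln (r (X x)) \<partial>M)"
proof -
  let ?p = "\<lambda>v. prob (X -` {v} \<inter> space M)"
  have fin: "finite (X ` space M)" using X by (auto simp: simple_function_def)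
  have "?p v * ln (r v) - ?p v * ln (?p v) \<le> r v - ?p v" if v: "v \<in> X ` space M" for v
  proof (cases "?p v = 0")
    case True then show ?thesis using r(1)[OF v] by simp
  next
    case False
    then have p: "?p v > 0" by (simp add: zero_less_measure_iff)
    have "ln (r v / ?p v) \<le> r v / ?p v - 1"
      using r(1)[OF v] p by (intro ln_le_minus_one) simp
    then have "?p v * ln (r v / ?p v) \<le> ?p v * (r v / ?p v - 1)"
      using p by (intro mult_left_mono) auto
    then show ?thesis using p r(1)[OF v] by (simp add: ln_div algebra_simps)
  qed
  then have "(\<Sum>v\<in>X ` space M. ?p v * ln (r v) - ?p v * ln (?p v)) \<le> (\<Sum>v\<in>X ` space M. r v - ?p v)"
    by (rule sum_mono)
  also have "\<dots> \<le> 1 - 1"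
    using r(2) integral_simple_comp(1)[OF X, of "\<lambda>_. 1"] by (simp add: sum_subtractf prob_space)
  finally show ?thesis
    unfolding shannon_entropy_eq_sum[OF X fin order_refl]
    by (simp add: integral_simple_comp(1)[OF X, of "\<lambda>v. ln (r v)"] sum_subtractf)
qed

lemma simple_function_itinerary:
  assumes P: "measurable_partition M P" and T: "\<And>n. T ^^ n \<in> measurable M M"
  shows "simple_function M (itinerary T P n)"
    and "itinerary T P n ` space M \<subseteq> PiE {..<n} (\<lambda>_. P)"
proof -
  note P' = P[unfolded measurable_partition_def]
  show sub: "itinerary T P n ` space M \<subseteq> PiE {..<n} (\<lambda>_. P)"
    using P' measurable_space[OF T] by (auto simp: itinerary_def intro!: cell_of_mem)
  have fin: "finite (itinerary T P n ` space M)"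
    by (rule finite_subset[OF sub]) (use P' in \<open>auto intro: finite_PiE\<close>)
  have mem: "(T ^^ i) x \<in> cell_of P ((T ^^ i) x)" if "x \<in> space M" for i x
    using cell_of_mem(2)[of "space M" P] P' measurable_space[OF T that] by blast
  have "itinerary T P n -` {v} \<inter> space M \<in> sets M" if v: "v \<in> itinerary T P n ` space M" for v
  proof -
    have vP: "v i \<in> P" if "i < n" for i using v sub that by blast
    have "itinerary T P n -` {v} \<inter> space M = {x \<in> space M. \<forall>i\<in>{..<n}. (T ^^ i) x \<in> v i}"
    proof (intro set_eqI iffI)
      fix x assume x: "x \<in> itinerary T P n -` {v} \<inter> space M"
      then have "v i = cell_of P ((T ^^ i) x)" if "i < n" for i
        using that by (auto simp: itinerary_def)
      then show "x \<in> {x \<in> space M. \<forall>i\<in>{..<n}. (T ^^ i) x \<in> v i}"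
        using x mem by auto
    next
      fix x assume x: "x \<in> {x \<in> space M. \<forall>i\<in>{..<n}. (T ^^ i) x \<in> v i}"
      then have "cell_of P ((T ^^ i) x) = v i" if "i < n" for i
        using that P' vP by (intro cell_of_eq) auto
      moreover have "v \<in> extensional {..<n}" using v by (auto simp: itinerary_def)
      ultimately have "itinerary T P n x i = v i" for i
        by (cases "i < n") (auto simp: itinerary_def extensional_def)
      then show "x \<in> itinerary T P n -` {v} \<inter> space M"
        using x by auto
    qed
    also have "\<dots> \<in> sets M"
    proof (intro sets.sets_Collect_finite_All)
      fix i assume "i \<in> {..<n}"
      then have "v i \<in> sets M" using vP P' by auto
      from measurable_sets[OF T this] show "{x \<in> space M. (T ^^ i) x \<in> v i} \<in> sets M"
        by (simp add: vimage_def Int_def conj_commute)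
    qed auto
    finally show ?thesis .
  qed
  then show "simple_function M (itinerary T P n)"
    unfolding simple_function_def using fin by auto
qed

text \<open>The nonempty cells of the join are the fibres of the itinerary, each counted once
  because distinct values have disjoint fibres. The entropy of the refined partition thus becomes
  that of a random variable, to which the inequalities of information theory apply.\<close>

lemma partition_entropy_join_preimages:
  assumes P: "measurable_partition M P" and T: "\<And>n. T ^^ n \<in> measurable M M"
  shows "partition_entropy M (join_preimages M T P n) = shannon_entropy (itinerary T P n)"
proof -
  note P' = P[unfolded measurable_partition_def]
  let ?X = "itinerary T P n"
  let ?fib = "\<lambda>v. ?X -` {v} \<inter> space M"
  have fin: "finite (?X ` space M)"
    using simple_function_itinerary(1)[OF P T, of n] by (auto simp: simple_function_def)
  have inS: "(T ^^ i) x \<in> space M" if "x \<in> space M" for i x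
    using measurable_space[OF T that] .
  have cell: "{x \<in> space M. \<forall>i<n. (T ^^ i) x \<in> F i} = ?fib (itinerary T P n y)"
    if "\<forall>i<n. F i \<in> P" "y \<in> space M" "\<forall>i<n. (T ^^ i) y \<in> F i" for F y
  proof -
    have F: "F i = cell_of P ((T ^^ i) y)" if "i < n" for i
      using cell_of_eq[of "space M" P "F i" "(T ^^ i) y"] that \<open>\<forall>i<n. F i \<in> P\<close> \<open>\<forall>i<n. (T ^^ i) y \<in> F i\<close> P' by simp
    have same: "(T ^^ i) x \<in> F i \<longleftrightarrow> cell_of P ((T ^^ i) x) = cell_of P ((T ^^ i) y)"
      if "x \<in> space M" "i < n" for x i
      using cell_of_eq_iff[of "space M" P "F i" "(T ^^ i) x"] P' inS that \<open>\<forall>i<n. F i \<in> P\<close> F by simp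
    have "?X x = ?X y \<longleftrightarrow> (\<forall>i<n. cell_of P ((T ^^ i) x) = cell_of P ((T ^^ i) y))" for x
      by (auto simp: itinerary_def restrict_def fun_eq_iff)
    then show ?thesis
      using same by (simp add: set_eq_iff) blast
  qed
  have "join_preimages M T P n = ?fib ` ?X ` space M"
  proof (intro set_eqI iffI)
    fix A assume "A \<in> join_preimages M T P n"
    then obtain F y where F: "A = {x \<in> space M. \<forall>i<n. (T ^^ i) x \<in> F i}" "\<forall>i<n. F i \<in> P" "y \<in> A"
      unfolding join_preimages_def by blast
    then have "y \<in> space M" "A = ?fib (?X y)" using cell[of F y] by auto
    then show "A \<in> ?fib ` ?X ` space M" by (intro image_eqI) auto
  next
    fix A assume "A \<in> ?fib ` ?X ` space M"
    then obtain y where y: "y \<in> space M" "A = ?fib (?X y)" by auto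
    let ?F = "\<lambda>i. cell_of P ((T ^^ i) y)"
    have F: "\<forall>i<n. ?F i \<in> P" "\<forall>i<n. (T ^^ i) y \<in> ?F i"
      using P' inS[OF y(1)] cell_of_mem[of "space M" P] by auto
    have A: "A = {x \<in> space M. \<forall>i<n. (T ^^ i) x \<in> ?F i}"
      using cell[OF F(1) y(1) F(2)] y(2) by simp
    have "A \<noteq> {}" using y by auto
    moreover have "\<exists>F. A = {x \<in> space M. \<forall>i<n. (T ^^ i) x \<in> F i} \<and> (\<forall>i<n. F i \<in> P)"
      using A F(1) by (intro exI[of _ ?F] conjI)
    ultimately show "A \<in> join_preimages M T P n"
      unfolding join_preimages_def by simp
  qed
  moreover have "inj_on ?fib (?X ` space M)"
  proof (intro inj_onI)
    fix u v assume "u \<in> ?X ` space M" "?fib u = ?fib v"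
    then obtain x where "x \<in> space M" "u = ?X x" by auto
    then have "x \<in> ?fib v" using \<open>?fib u = ?fib v\<close> by auto
    then show "u = v" using \<open>u = ?X x\<close> by simp
  qed
  ultimately show ?thesis
    unfolding partition_entropy_def
      shannon_entropy_eq_sum[OF simple_function_itinerary(1)[OF P T, of n] fin order_refl]
    by (simp add: sum.reindex)
qed

text \<open>The long itinerary is a function of the pair formed by the first \<open>a\<close> cells
  and the itinerary of length \<open>b\<close> of \<open>(T ^^ a) x\<close>; by invariance the
  second component has the same law as the itinerary of length \<open>b\<close> of
  \<open>x\<close>.\<close>

lemma partition_entropy_join_add_le:
  assumes P: "measurable_partition M P" and inv: "invariant_measure M T"
  shows "partition_entropy M (join_preimages M T P (a + b)) \<le>
    partition_entropy M (join_preimages M T P a) + partition_entropy M (join_preimages M T P b)"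
proof -
  note T = invariant_measure_funpow(1)[OF inv]
  let ?X = "\<lambda>n. itinerary T P n"
  let ?Y = "\<lambda>x. ?X b ((T ^^ a) x)"
  note sf = simple_function_itinerary(1)[OF P T]
  have fib: "?Y -` {v} \<inter> space M = (T ^^ a) -` (?X b -` {v} \<inter> space M) \<inter> space M" for v
    using measurable_space[OF T] by auto
  have fin: "finite (?X b ` space M)" "?Y ` space M \<subseteq> ?X b ` space M"
    using simple_functionD(1)[OF sf] measurable_space[OF T] by auto
  have sfY: "simple_function M ?Y"
    unfolding simple_function_def
    using finite_subset[OF fin(2,1)] measurable_sets[OF T simple_functionD(2)[OF sf]] by (simp add: fib)
  have "shannon_entropy ?Y = shannon_entropy (?X b)"
    unfolding shannon_entropy_eq_sum[OF sfY fin] shannon_entropy_eq_sum[OF sf fin(1) order_refl]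
    using measure_invariant_vimage[OF inv simple_functionD(2)[OF sf]] by (simp add: fib)
  moreover
  define g where "g = (\<lambda>(u, v). \<lambda>i\<in>{..<a + b}. if i < a then u i else v (i - a) :: 'a set)"
  have "?X (a + b) = g \<circ> (\<lambda>x. (?X a x, ?Y x))"
    by (auto simp: g_def itinerary_def fun_eq_iff restrict_def simp flip: comp_apply[of "T ^^ _" "T ^^ _"] funpow_add)
  then have "shannon_entropy (?X (a + b)) \<le> shannon_entropy (\<lambda>x. (?X a x, ?Y x))"
    using shannon_entropy_comp_le[OF simple_function_Pair[OF sf sfY]] by simp
  ultimately show ?thesis
    using shannon_entropy_pair_le[OF sf sfY, of a] by (simp add: partition_entropy_join_preimages[OF P T])
qed

end

text \<open>Peeling blocks of length \<open>L\<close> off \<open>n\<close> costs at most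
  \<open>e / 2\<close> per letter, and the remainder costs at most the constant \<open>C\<close>.
  Convergence has to be proved, not only smallness along some lengths, because
  \<open>entropy_wrt_partition\<close> is defined by \<open>lim\<close>.\<close>

lemma subadditive_div_tendsto_0:
  fixes h :: "nat \<Rightarrow> real"
  assumes add: "\<And>a b. h (a + b) \<le> h a + h b" and nn: "\<And>n. h n \<ge> 0"
    and small: "\<And>e. e > 0 \<Longrightarrow> \<exists>L>0. h L \<le> e * real L"
  shows "(\<lambda>n. h n / real n) \<longlonglongrightarrow> 0"
proof (rule LIMSEQ_I)
  fix e :: real assume "e > 0"
  then obtain L where L: "L > 0" "h L \<le> e / 2 * real L" using small[of "e / 2"] by auto
  define C where "C = Max (h ` {..<L})"
  have C: "h r \<le> C" if "r < L" for r unfolding C_def using that by simp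
  have "h n \<le> e / 2 * real n + C" for n
  proof (induction n rule: less_induct)
    case (less n)
    show ?case
    proof (cases "n < L")
      case True
      have "0 \<le> e / 2 * real n" using \<open>e > 0\<close> by simp
      then show ?thesis using C[OF True] by linarith
    next
      case False
      have "h n \<le> h L + h (n - L)" using add[of L "n - L"] False by simp
      also have "\<dots> \<le> e / 2 * real L + (e / 2 * real (n - L) + C)"
        using L less[of "n - L"] False by (intro add_mono) auto
      also have "\<dots> = e / 2 * (real L + real (n - L)) + C" by (simp only: distrib_left add.assoc)
      also have "real L + real (n - L) = real n" using False by simp
      finally show ?thesis .
    qed
  qed
  moreover obtain N where N: "real N > 2 * C / e" using reals_Archimedean2 by blast
  ultimately have "norm (h n / real n - 0) < e" if "n \<ge> Suc N" for n
  proof -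
    have n: "real n > 0" "real n > 2 * C / e" using that N by auto
    then have "C < e / 2 * real n" using \<open>e > 0\<close> by (simp add: field_simps)
    then have "h n < e * real n" using \<open>h n \<le> e / 2 * real n + C\<close> by linarith
    then show ?thesis using nn[of n] n by (simp add: field_simps)
  qed
  then show "\<exists>no. \<forall>n\<ge>no. norm (h n / real n - 0) < e" by blast
qed

text \<open>
  The entropy is compared, by Gibbs' inequality, with the mixture over the reference words
  \<open>b \<in> B\<close> of the product measures with mass \<open>1 - d\<close> on the letter \<open>b i\<close> and \<open>d\<close> spread evenly.
\<close>

lemma (in prob_space) partition_entropy_join_le_reference:
  fixes D :: "'a \<Rightarrow> real"
  assumes P: "measurable_partition M P" and T: "\<And>n. T ^^ n \<in> measurable M M"
    and B: "finite B" "B \<noteq> {}" and d: "0 < d" "d < 1" and D: "integrable M D"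
    and near: "\<And>x. x \<in> space M \<Longrightarrow> \<exists>b\<in>B. real (card {i. i < L \<and> cell_of P ((T ^^ i) x) \<noteq> b i}) \<le> D x"
  shows "partition_entropy M (join_preimages M T P L) \<le>
    ln (real (card B)) - real L * ln (1 - d) + ln (real (card P) / d) * (\<integral>x. D x \<partial>M)"
proof -
  note P' = P[unfolded measurable_partition_def]
  let ?X = "itinerary T P L"
  note sf = simple_function_itinerary[OF P T]
  have "P \<noteq> {}" using P' not_empty by (auto simp: partition_on_def)
  then have s: "card P \<ge> 1" using P' by (simp add: Suc_leI card_gt_0_iff)
  have "d \<le> real (card P)" using s d by linarith
  then have sd: "real (card P) / d \<ge> 1" using d by (simp add: le_divide_eq)
  define t where "t b i y = (if y = b i then 1 - d else d / card P)" for b :: "nat \<Rightarrow> 'a set" and i y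
  have t_pos: "t b i y > 0" for b i y using s d by (simp add: t_def)
  define r where "r v = (\<Sum>b\<in>B. \<Prod>i<L. t b i (v i)) / card B" for v
  have Bpos: "real (card B) > 0" using B by (simp add: card_gt_0_iff)
  have r_pos: "r v > 0" for v
    unfolding r_def using B Bpos t_pos by (intro divide_pos_pos sum_pos prod_pos) auto
  \<comment> \<open>Only an upper bound: \<open>b i\<close> is an arbitrary set and may fail to be a
    cell of \<open>P\<close>, in which case the mass \<open>1 - d\<close> is lost.\<close>
  have tsum: "(\<Sum>y\<in>P. t b i y) \<le> 1" for b i
  proof -
    have "(\<Sum>y\<in>P. t b i y) \<le> (\<Sum>y\<in>P. (if y = b i then 1 - d else 0) + d / card P)"
      using d by (intro sum_mono) (auto simp: t_def)
    also have "\<dots> = (if b i \<in> P then 1 - d else 0) + d"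
      using s P' \<open>P \<noteq> {}\<close> by (simp add: sum.distrib sum.delta)
    also have "\<dots> \<le> 1" using d by auto
    finally show ?thesis .
  qed
  have tsum_nonneg: "0 \<le> (\<Sum>y\<in>P. t b i y)" for b i
    by (intro sum_nonneg less_imp_le t_pos)
  have "(\<Sum>v\<in>?X ` space M. r v) \<le> (\<Sum>v\<in>PiE {..<L} (\<lambda>_. P). r v)"
    using sf(2) P' r_pos by (intro sum_mono2 finite_PiE) (auto intro: less_imp_le)
  also have "\<dots> = (\<Sum>b\<in>B. \<Sum>v\<in>PiE {..<L} (\<lambda>_. P). \<Prod>i<L. t b i (v i)) / card B"
    unfolding r_def by (subst sum.swap) (simp add: sum_divide_distrib)
  also have "\<dots> = (\<Sum>b\<in>B. \<Prod>i<L. \<Sum>y\<in>P. t b i y) / card B"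
    using P' by (subst prod_sum_PiE) auto
  also have "\<dots> \<le> (\<Sum>b\<in>B. 1) / card B"
    using tsum tsum_nonneg Bpos by (intro divide_right_mono sum_mono prod_le_1) auto
  also have "\<dots> = 1" using Bpos by simp
  finally have r_sum: "(\<Sum>v\<in>?X ` space M. r v) \<le> 1" .
  have bound: "- ln (r (?X x)) \<le> ln (card B) - L * ln (1 - d) + ln (card P / d) * D x" if x: "x \<in> space M" for x
  proof -
    obtain b where b: "b \<in> B" "real (card {i. i < L \<and> cell_of P ((T ^^ i) x) \<noteq> b i}) \<le> D x"
      using near[OF x] by blast
    let ?v = "?X x"
    let ?E = "{i. i < L \<and> cell_of P ((T ^^ i) x) \<noteq> b i}"
    have "ln (\<Prod>i<L. t b i (?v i)) = (\<Sum>i<L. ln (t b i (?v i)))"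
      using t_pos by (intro ln_prod) (auto simp: less_imp_neq[symmetric])
    \<comment> \<open>A matching letter contributes \<open>ln (1 - d)\<close>; a mismatch
      contributes \<open>- ln (card P / d)\<close>, which only decreases when the nonpositive
      \<open>ln (1 - d)\<close> is added.\<close>
    also have "\<dots> \<ge> (\<Sum>i<L. ln (1 - d) - (if i \<in> ?E then ln (card P / d) else 0))"
    proof (rule sum_mono)
      fix i assume "i \<in> {..<L}"
      have "ln (d / card P) = - ln (card P / d)" using d s by (simp add: ln_div)
      moreover have "ln (1 - d) \<le> 0" using d by simp
      ultimately show "ln (1 - d) - (if i \<in> ?E then ln (card P / d) else 0) \<le> ln (t b i (?v i))"
        using \<open>i \<in> _\<close> by (auto simp: t_def itinerary_def)
    qed
    also have "(\<Sum>i<L. ln (1 - d) - (if i \<in> ?E then ln (card P / d) else 0))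
        = L * ln (1 - d) - card ?E * ln (card P / d)"
      by (simp add: sum_subtractf sum.If_cases Int_def conj_commute lessThan_def)
    finally have "ln (\<Prod>i<L. t b i (?v i)) \<ge> L * ln (1 - d) - card ?E * ln (card P / d)" .
    moreover have "card ?E * ln (card P / d) \<le> D x * ln (card P / d)"
      using b sd by (intro mult_right_mono) auto
    \<comment> \<open>The mixture is at least its single summand for the nearby word
      \<open>b\<close>; the weight \<open>1 / card B\<close> is the origin of the term
      \<open>ln (card B)\<close>.\<close>
    moreover have "ln (r ?v) \<ge> ln ((\<Prod>i<L. t b i (?v i)) / card B)"
      unfolding r_def using b B Bpos t_pos
      by (intro ln_mono divide_right_mono member_le_sum divide_pos_pos prod_pos prod_nonneg)
        (auto intro: less_imp_le)
    moreover have "ln ((\<Prod>i<L. t b i (?v i)) / card B) = ln (\<Prod>i<L. t b i (?v i)) - ln (card B)"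
      using Bpos t_pos by (intro ln_divide_pos prod_pos) auto
    ultimately show ?thesis by (simp add: mult.commute)
  qed
  have "partition_entropy M (join_preimages M T P L) \<le> (\<integral>x. - ln (r (?X x)) \<partial>M)"
    unfolding partition_entropy_join_preimages[OF P T] by (rule gibbs_inequality[OF sf(1) r_pos r_sum])
  also have "\<dots> \<le> (\<integral>x. ln (card B) - L * ln (1 - d) + ln (card P / d) * D x \<partial>M)"
    using bound D integral_simple_comp(2)[OF sf(1), of "\<lambda>v. - ln (r v)"] by (intro integral_mono) auto
  also have "\<dots> = ln (card B) - L * ln (1 - d) + ln (card P / d) * (\<integral>x. D x \<partial>M)"
    using D by (simp add: prob_space)
  finally show ?thesis by simp
qed

text \<open>The tolerance \<open>\<delta>\<close> and the mass \<open>d\<close> of the product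
  measures are taken equal. The entropy per letter is then at most
  \<open>d - ln (1 - d) + ln (card P / d) * d\<close>, which vanishes as \<open>d\<close> decreases
  to 0.\<close>

lemma (in prob_space) entropy_wrt_partition_eq_0:
  assumes P: "measurable_partition M P" and inv: "invariant_measure M T"
    and approx: "\<And>\<delta>. \<delta> > 0 \<Longrightarrow> \<exists>L>0. \<exists>B (D :: 'a \<Rightarrow> real). finite B \<and> B \<noteq> {} \<and> integrable M D \<and>
      ln (real (card B)) \<le> \<delta> * real L \<and> (\<integral>x. D x \<partial>M) \<le> \<delta> * real L \<and>
      (\<forall>x\<in>space M. \<exists>b\<in>B. real (card {i. i < L \<and> cell_of P ((T ^^ i) x) \<noteq> b i}) \<le> D x)"
  shows "entropy_wrt_partition M T P = 0"
proof -
  note P' = P[unfolded measurable_partition_def]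
  note T = invariant_measure_funpow(1)[OF inv]
  have "P \<noteq> {}" using P' not_empty by (auto simp: partition_on_def)
  then have s: "real (card P) \<ge> 1" using P' by (simp add: Suc_leI card_gt_0_iff)
  let ?h = "\<lambda>n. partition_entropy M (join_preimages M T P n)"
  have "(\<lambda>n. ?h n / real n) \<longlonglongrightarrow> 0"
  proof (rule subadditive_div_tendsto_0)
    show "?h n \<ge> 0" for n
    proof -
      have "measure M A * ln (measure M A) \<le> 0" for A
        by (cases "measure M A = 0") (auto simp: mult_le_0_iff zero_less_measure_iff)
      then show ?thesis
        unfolding partition_entropy_def by (simp add: sum_nonpos)
    qed
    show "?h (a + b) \<le> ?h a + ?h b" for a b
      by (rule partition_entropy_join_add_le[OF P inv])
    show "\<exists>L>0. ?h L \<le> e * real L" if "e > 0" for e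
    proof -
      let ?c = "real (card P)"
      have c: "?c > 0" using s by linarith
      then have "((\<lambda>d. d - ln (1 - d) + ln (?c / d) * d) \<longlongrightarrow> 0) (at_right 0)"
        by real_asymp
      then have "\<forall>\<^sub>F d in at_right 0. d - ln (1 - d) + ln (?c / d) * d < e"
        using \<open>e > 0\<close> by (rule order_tendstoD(2))
      moreover have "\<forall>\<^sub>F d in at_right (0 :: real). d \<in> {0<..<1}"
        by (rule eventually_at_right_real) simp
      ultimately have "\<forall>\<^sub>F d in at_right (0 :: real). d \<in> {0<..<1} \<and> d - ln (1 - d) + ln (?c / d) * d < e"
        by (rule eventually_conj[rotated])
      then obtain d where d: "0 < d" "d < 1" "d - ln (1 - d) + ln (?c / d) * d < e"
        using eventually_happens[of _ "at_right (0::real)"] by auto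
      obtain L B and D :: "'a \<Rightarrow> real" where L: "L > 0" and B: "finite B" "B \<noteq> {}" "integrable M D"
        "ln (real (card B)) \<le> d * real L" "(\<integral>x. D x \<partial>M) \<le> d * real L"
        "\<And>x. x \<in> space M \<Longrightarrow> \<exists>b\<in>B. real (card {i. i < L \<and> cell_of P ((T ^^ i) x) \<noteq> b i}) \<le> D x"
        using approx[OF d(1)] by (elim exE conjE) (rule that, auto)
      have "ln (?c / d) \<ge> 0" using d s by (simp add: field_simps)
      then have "ln (?c / d) * (\<integral>x. D x \<partial>M) \<le> ln (?c / d) * (d * real L)"
        using B by (intro mult_left_mono)
      then have "?h L \<le> d * real L - real L * ln (1 - d) + ln (?c / d) * (d * real L)"
        using partition_entropy_join_le_reference[OF P T B(1,2) d(1,2) B(3,6)] B(4) by simp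
      also have "\<dots> = (d - ln (1 - d) + ln (?c / d) * d) * real L"
        by (simp add: algebra_simps)
      also have "\<dots> \<le> e * real L" using d by (intro mult_right_mono) auto
      finally show ?thesis using L by blast
    qed
  qed
  then show ?thesis unfolding entropy_wrt_partition_def by (rule limI)
qed

section \<open>Local functions on the full shift\<close>

definition agree :: "nat \<Rightarrow> (int \<Rightarrow> nat) \<Rightarrow> (int \<Rightarrow> nat) \<Rightarrow> bool" where
  "agree m x y \<longleftrightarrow> (\<forall>j. \<bar>j\<bar> \<le> int m \<longrightarrow> x j = y j)"

text \<open>Polymorphic in the value type, so that real functions, membership predicates and
  cell-valued maps are covered by one notion.\<close>

definition window_local :: "nat \<Rightarrow> nat \<Rightarrow> ((int \<Rightarrow> nat) \<Rightarrow> 'b) \<Rightarrow> bool" where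
  "window_local k m F \<longleftrightarrow> (\<forall>x\<in>Sigma_shift k. \<forall>y\<in>Sigma_shift k. agree m x y \<longrightarrow> F x = F y)"

text \<open>The finite unions of cylinders, that is, the clopen subsets of the shift space.\<close>

definition local_sets :: "nat \<Rightarrow> (int \<Rightarrow> nat) set set" where
  "local_sets k = {C. C \<subseteq> Sigma_shift k \<and> (\<exists>m. window_local k m (\<lambda>x. x \<in> C))}"

text \<open>The default letter 1 is admissible as soon as \<open>Sigma_shift k\<close> is nonempty.
  Composition with \<open>truncate m\<close> turns any function into a local one.\<close>

definition truncate :: "nat \<Rightarrow> (int \<Rightarrow> nat) \<Rightarrow> int \<Rightarrow> nat" where
  "truncate m x j = (if \<bar>j\<bar> \<le> int m then x j else 1)"

lemma agree_refl [simp]: "agree m x x"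
  by (simp add: agree_def)

lemma agreeD: "agree m x y \<Longrightarrow> \<bar>j\<bar> \<le> int m \<Longrightarrow> x j = y j"
  by (simp add: agree_def)

lemma agree_mono:
  assumes "agree m' x y" "m \<le> m'"
  shows "agree m x y"
  unfolding agree_def
proof (intro allI impI)
  fix j :: int assume "\<bar>j\<bar> \<le> int m"
  then show "x j = y j" using assms(2) by (intro agreeD[OF assms(1)]) simp
qed

lemma window_localD:
  assumes "window_local k m F" "x \<in> Sigma_shift k" "y \<in> Sigma_shift k" "agree m x y"
  shows "F x = F y"
proof -
  from assms(1,2) have "\<forall>y\<in>Sigma_shift k. agree m x y \<longrightarrow> F x = F y"
    unfolding window_local_def by (rule bspec)
  from this assms(3) have "agree m x y \<longrightarrow> F x = F y" by (rule bspec)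
  then show ?thesis using assms(4) by (rule mp)
qed

lemma window_localI:
  "(\<And>x y. x \<in> Sigma_shift k \<Longrightarrow> y \<in> Sigma_shift k \<Longrightarrow> agree m x y \<Longrightarrow> F x = F y) \<Longrightarrow> window_local k m F"
  unfolding window_local_def by (intro ballI impI)

lemma window_local_mono:
  assumes "window_local k m F" "m \<le> m'"
  shows "window_local k m' F"
  by (intro window_localI) (rule window_localD[OF assms(1) _ _ agree_mono[OF _ assms(2)]])

lemma shift_map_funpow: "(shift_map ^^ i) x j = x (j + int i)"
  by (induction i arbitrary: j) (auto simp: shift_map_def algebra_simps)

lemma agree_shift:
  assumes "agree (m + i) x y"
  shows "agree m ((shift_map ^^ i) x) ((shift_map ^^ i) y)"
  unfolding agree_def shift_map_funpow
proof (intro allI impI)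
  fix j :: int assume "\<bar>j\<bar> \<le> int m"
  then show "x (j + int i) = y (j + int i)" by (intro agreeD[OF assms]) simp
qed

lemma window_local_shift:
  assumes "window_local k m F"
  shows "window_local k (m + i) (\<lambda>x. F ((shift_map ^^ i) x))"
  unfolding window_local_def
proof (intro ballI impI)
  fix x y assume "x \<in> Sigma_shift k" "y \<in> Sigma_shift k" "agree (m + i) x y"
  then show "F ((shift_map ^^ i) x) = F ((shift_map ^^ i) y)"
    by (intro window_localD[OF assms] agree_shift shift_map_Sigma_shift)
qed

lemma truncate_Sigma_shift:
  assumes "x \<in> Sigma_shift k"
  shows "truncate m x \<in> Sigma_shift k"
proof -
  have x: "x j \<in> {1..k}" for j using assms by (simp add: Sigma_shift_def)
  from x[of 0] have "1 \<in> {1..k}" by simp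
  with x show ?thesis by (simp add: Sigma_shift_def truncate_def)
qed

lemma agree_truncate: "agree m x (truncate m x)"
  by (simp add: agree_def truncate_def)

lemma truncate_cong: "agree m x y \<Longrightarrow> truncate m x = truncate m y"
  by (rule ext) (simp add: agree_def truncate_def)

lemma window_local_finite_image:
  assumes "window_local k m F"
  shows "finite (F ` Sigma_shift k)"
proof -
  let ?P = "PiE {- int m..int m} (\<lambda>_. {1..k})"
  have "F ` Sigma_shift k \<subseteq> (\<lambda>g. F (truncate m g)) ` ?P"
  proof
    fix v assume "v \<in> F ` Sigma_shift k"
    then obtain x where x: "x \<in> Sigma_shift k" "v = F x" by blast
    have "truncate m (restrict x {- int m..int m}) = truncate m x"
      by (rule ext) (auto simp: truncate_def)
    then have "v = F (truncate m (restrict x {- int m..int m}))"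
      using window_localD[OF assms x(1) truncate_Sigma_shift[OF x(1)] agree_truncate] x by simp
    moreover have "restrict x {- int m..int m} \<in> ?P" using x by (auto simp: Sigma_shift_def)
    ultimately show "v \<in> (\<lambda>g. F (truncate m g)) ` ?P" by blast
  qed
  then show ?thesis by (rule finite_subset) (auto intro!: finite_PiE)
qed

lemma window_local_preimage:
  assumes "window_local k m F"
  shows "{x \<in> Sigma_shift k. F x \<in> V} \<in> local_sets k"
proof -
  have "window_local k m (\<lambda>x. x \<in> {x \<in> Sigma_shift k. F x \<in> V})"
  proof (rule window_localI)
    fix x y assume xy: "x \<in> Sigma_shift k" "y \<in> Sigma_shift k" "agree m x y"
    then have "F x = F y" by (rule window_localD[OF assms])
    then show "(x \<in> {x \<in> Sigma_shift k. F x \<in> V}) = (y \<in> {x \<in> Sigma_shift k. F x \<in> V})"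
      using xy(1,2) by simp
  qed
  then show ?thesis unfolding local_sets_def by blast
qed

lemma openin_local_set:
  assumes "C \<in> local_sets k"
  shows "openin (top_of_set (Sigma_shift k)) C"
proof -
  obtain m where C: "C \<subseteq> Sigma_shift k" "window_local k m (\<lambda>x. x \<in> C)"
    using assms unfolding local_sets_def by blast
  have "open {y. agree m x y}" for x
  proof -
    have "agree m x y \<longleftrightarrow> (\<forall>j\<in>{- int m..int m}. y j = x j)" for y
      unfolding agree_def by (auto simp: abs_le_iff)
    then have "{y. agree m x y} = (\<Inter>j\<in>{- int m..int m}. (\<lambda>y. y j) -` {x j})"
      by auto
    moreover have "open ((\<lambda>y. y j) -` {x j})" for j
      by (intro open_vimage continuous_on_product_coordinates Topological_Spaces.open_discrete)
    ultimately show ?thesis by auto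
  qed
  then have "open (\<Union>x\<in>C. {y. agree m x y})" by blast
  moreover have "C = Sigma_shift k \<inter> (\<Union>x\<in>C. {y. agree m x y})"
    using C agree_refl by (auto dest: window_localD)
  ultimately show ?thesis by (auto simp: openin_open)
qed

lemma algebra_local_sets: "algebra (Sigma_shift k) (local_sets k)"
  unfolding algebra_iff_Un
proof (intro conjI ballI)
  show "local_sets k \<subseteq> Pow (Sigma_shift k)" "{} \<in> local_sets k"
    by (auto simp: local_sets_def window_local_def)
  fix a assume a: "a \<in> local_sets k"
  then show "Sigma_shift k - a \<in> local_sets k"
    by (auto simp: local_sets_def window_local_def)
  fix b assume b: "b \<in> local_sets k"
  obtain m n where "window_local k m (\<lambda>x. x \<in> a)" "window_local k n (\<lambda>x. x \<in> b)"
    using a b unfolding local_sets_def by blast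
  then have "window_local k (max m n) (\<lambda>x. x \<in> a)" "window_local k (max m n) (\<lambda>x. x \<in> b)"
    by (auto intro: window_local_mono)
  then have "window_local k (max m n) (\<lambda>x. x \<in> a \<union> b)"
    unfolding window_local_def by blast
  then show "a \<union> b \<in> local_sets k"
    using a b by (auto simp: local_sets_def)
qed

section \<open>Compactness, Borel sets and weak convergence on the shift\<close>

lemma compact_Sigma_shift: "compact (Sigma_shift k)"
proof -
  have "compact_space (top_of_set (Sigma_shift k))"
    unfolding top_of_set_Sigma_shift
    by (simp add: compact_space_product_topology compact_space_discrete_topology)
  then show ?thesis
    using compactin_subspace[of euclidean "Sigma_shift k"] by simp
qed

lemma closed_Sigma_shift: "closed (Sigma_shift k)"
proof -
  have "Sigma_shift k = (\<Inter>j. (\<lambda>x. x j) -` {1..k})"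
    by (auto simp: Sigma_shift_def)
  moreover have "closed ((\<lambda>x :: int \<Rightarrow> nat. x j) -` {1..k})" for j
    by (intro closed_vimage continuous_on_product_coordinates finite_imp_closed) simp
  ultimately show ?thesis by (auto intro: closed_INT)
qed

lemma closed_local_set:
  assumes "C \<in> local_sets k"
  shows "closed C"
proof -
  interpret algebra "Sigma_shift k" "local_sets k" by (rule algebra_local_sets)
  have "openin (top_of_set (Sigma_shift k)) (Sigma_shift k - C)"
    using assms by (intro openin_local_set) auto
  moreover have "C \<subseteq> Sigma_shift k" using assms by (auto simp: local_sets_def)
  ultimately have "closedin (top_of_set (Sigma_shift k)) C"
    by (simp add: closedin_def)
  then show ?thesis
    using closedin_closed_trans[OF _ closed_Sigma_shift] by blast
qed

lemma local_sets_measurable: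
  assumes "C \<in> local_sets k"
  shows "C \<in> sets (Sigma_borel k)"
  unfolding Sigma_borel_def sets_restrict_space
proof (rule image_eqI)
  show "C = Sigma_shift k \<inter> C" using assms by (auto simp: local_sets_def)
  show "C \<in> sets borel" by (rule borel_closed[OF closed_local_set[OF assms]])
qed

text \<open>Each coordinate is measurable for the \<sigma>-algebra generated by the local sets, and
  the coordinates generate the Borel sets of a countable product of second countable spaces.
  Conversely local sets are closed.\<close>

lemma sets_Sigma_borel: "sets (Sigma_borel k) = sigma_sets (Sigma_shift k) (local_sets k)"
proof (rule antisym)
  interpret algebra "Sigma_shift k" "local_sets k" by (rule algebra_local_sets)
  let ?S = "sigma (Sigma_shift k) (local_sets k)"
  have coord: "(\<lambda>x. x j) \<in> measurable ?S (borel :: nat measure)" for j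
  proof (rule measurableI)
    fix A :: "nat set"
    have "window_local k (nat \<bar>j\<bar>) (\<lambda>x. x j)"
      by (auto simp: window_local_def agree_def)
    then have "{x \<in> Sigma_shift k. x j \<in> A} \<in> local_sets k"
      by (rule window_local_preimage)
    moreover have "(\<lambda>x. x j) -` A \<inter> space ?S = {x \<in> Sigma_shift k. x j \<in> A}"
      using space_closed by auto
    ultimately show "(\<lambda>x. x j) -` A \<inter> space ?S \<in> sets ?S"
      using space_closed by simp
  qed auto
  have "(\<lambda>x. x) \<in> measurable ?S (Pi\<^sub>M UNIV (\<lambda>_. borel :: nat measure))"
    by (rule measurable_PiM_single') (auto simp: coord)
  then have "(\<lambda>x. x) \<in> measurable ?S (borel :: (int \<Rightarrow> nat) measure)"
    using measurable_cong_sets[OF refl sets_PiM_equal_borel] by blast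
  then have "A \<inter> Sigma_shift k \<in> sets ?S" if "A \<in> sets borel" for A
    using measurable_sets[of "\<lambda>x. x" ?S borel A] that space_closed by simp
  then show "sets (Sigma_borel k) \<subseteq> sigma_sets (Sigma_shift k) (local_sets k)"
    using space_closed by (auto simp: Sigma_borel_def sets_restrict_space Int_commute)
  show "sigma_sets (Sigma_shift k) (local_sets k) \<subseteq> sets (Sigma_borel k)"
    using local_sets_measurable sets.sigma_sets_subset[of "local_sets k" "Sigma_borel k"] by auto
qed

lemma measure_eq_of_local_sets:
  assumes "finite_measure M" "sets M = sets (Sigma_borel k)" "sets N = sets (Sigma_borel k)"
    and eq: "\<And>C. C \<in> local_sets k \<Longrightarrow> emeasure M C = emeasure N C"
  shows "M = N"
proof -
  interpret algebra "Sigma_shift k" "local_sets k" by (rule algebra_local_sets)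
  interpret M: finite_measure M by fact
  show ?thesis
  proof (rule measure_eqI_generator_eq[where E="local_sets k" and \<Omega>="Sigma_shift k" and A="\<lambda>_. Sigma_shift k"])
    show "Int_stable (local_sets k)" by (rule Int_stable)
    show "local_sets k \<subseteq> Pow (Sigma_shift k)" by (rule space_closed)
  qed (use assms eq M.emeasure_finite[of "Sigma_shift k"] in \<open>auto simp: sets_Sigma_borel\<close>)
qed

lemma window_local_integral:
  fixes F :: "(int \<Rightarrow> nat) \<Rightarrow> real"
  assumes F: "window_local k m F" and M: "finite_measure M" "sets M = sets (Sigma_borel k)"
  shows "integrable M F"
    and "(\<integral>x. F x \<partial>M) = (\<Sum>v\<in>F ` Sigma_shift k. v * measure M {x \<in> Sigma_shift k. F x = v})"
proof -
  interpret finite_measure M by fact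
  have sp: "space M = Sigma_shift k" using sets_eq_imp_space_eq[OF M(2)] by simp
  let ?A = "\<lambda>v. {x \<in> Sigma_shift k. F x = v}"
  have A: "?A v \<in> sets M" for v
    using local_sets_measurable[OF window_local_preimage[OF F, of "{v}"]] M(2) by simp
  have eq: "F x = (\<Sum>v\<in>F ` Sigma_shift k. v * indicator (?A v) x)" if "x \<in> space M" for x
  proof -
    have "(\<Sum>v\<in>F ` Sigma_shift k. v * indicator (?A v) x) = (\<Sum>v\<in>{F x}. v * indicator (?A v) x)"
      using that window_local_finite_image[OF F] by (intro sum.mono_neutral_right) (auto simp: sp indicator_def)
    also have "\<dots> = F x" using that by (simp add: sp)
    finally show ?thesis by (rule sym)
  qed
  have int: "integrable M (\<lambda>x. v * indicator (?A v) x)" for v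
    using A by (intro integrable_mult_right integrable_real_indicator) (auto simp: less_top[symmetric])
  show "integrable M F"
    by (subst Bochner_Integration.integrable_cong[OF refl eq]) (auto intro: int)
  have "(\<integral>x. F x \<partial>M) = (\<integral>x. (\<Sum>v\<in>F ` Sigma_shift k. v * indicator (?A v) x) \<partial>M)"
    by (rule Bochner_Integration.integral_cong[OF refl eq])
  also have "\<dots> = (\<Sum>v\<in>F ` Sigma_shift k. \<integral>x. v * indicator (?A v) x \<partial>M)"
    by (rule Bochner_Integration.integral_sum) (rule int)
  finally show "(\<integral>x. F x \<partial>M) = (\<Sum>v\<in>F ` Sigma_shift k. v * measure M (?A v))"
    using A by simp
qed

lemma window_local_continuous_on:
  assumes "window_local k m F"
  shows "continuous_on (Sigma_shift k) F"
  unfolding continuous_on_open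
  using openin_local_set[OF window_local_preimage[OF assms]] by (simp add: vimage_def Int_def)

text \<open>Compactness is used twice. The windows around \<open>x\<close> shrink to
  \<open>{x}\<close>, so some window excludes the compact set where \<open>\<phi>\<close> is at
  least \<open>e / 2\<close> away from \<open>\<phi> x\<close>; a finite subcover then gives one
  window size for all points. The halves of \<open>e\<close> are joined through the centre
  \<open>z\<close> of a covering window.\<close>

lemma continuous_on_Sigma_shift_uniform:
  fixes \<phi> :: "(int \<Rightarrow> nat) \<Rightarrow> real"
  assumes \<phi>: "continuous_on (Sigma_shift k) \<phi>" and "e > 0"
  obtains m where "\<And>x y. x \<in> Sigma_shift k \<Longrightarrow> y \<in> Sigma_shift k \<Longrightarrow> agree m x y \<Longrightarrow> \<bar>\<phi> x - \<phi> y\<bar> < e"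
proof -
  interpret algebra "Sigma_shift k" "local_sets k" by (rule algebra_local_sets)
  have "\<exists>m. \<forall>y\<in>Sigma_shift k. agree m x y \<longrightarrow> \<bar>\<phi> x - \<phi> y\<bar> < e / 2" if x: "x \<in> Sigma_shift k" for x
  proof (rule ccontr)
    assume *: "\<not> ?thesis"
    let ?U = "\<lambda>m. {y \<in> Sigma_shift k. agree m x y}"
    let ?B = "{y \<in> Sigma_shift k. \<bar>\<phi> x - \<phi> y\<bar> \<ge> e / 2}"
    have "closedin (top_of_set (Sigma_shift k)) (Sigma_shift k \<inter> (\<lambda>y. \<bar>\<phi> x - \<phi> y\<bar>) -` {e / 2..})"
      by (intro continuous_closedin_preimage continuous_intros \<phi>)
    then have "compact (Sigma_shift k \<inter> (\<lambda>y. \<bar>\<phi> x - \<phi> y\<bar>) -` {e / 2..})"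
      using closedin_compact[OF compact_Sigma_shift] by blast
    then have B: "compact ?B" by (simp add: vimage_def Int_def)
    have U: "closed (?U m)" for m
    proof (rule closed_local_set)
      have "window_local k m (agree m x)"
        by (auto simp: window_local_def agree_def)
      from window_local_preimage[OF this, of "{True}"] show "?U m \<in> local_sets k" by simp
    qed
    have "?B \<inter> (\<Inter>m\<in>UNIV. ?U m) \<noteq> {}"
    proof (rule compact_imp_fip_image[OF B U])
      fix I :: "nat set" assume I: "finite I"
      obtain y where y: "y \<in> Sigma_shift k" "agree (Max (insert 0 I)) x y" "\<bar>\<phi> x - \<phi> y\<bar> \<ge> e / 2"
        using * by (metis not_less)
      then have "agree m x y" if "m \<in> I" for m
        using that I by (intro agree_mono[OF y(2)]) simp
      then show "?B \<inter> (\<Inter>m\<in>I. ?U m) \<noteq> {}" using y by blast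
    qed
    then obtain y where y: "\<bar>\<phi> x - \<phi> y\<bar> \<ge> e / 2" "\<And>m. agree m x y" by auto
    have "x j = y j" for j using y(2)[of "nat \<bar>j\<bar>"] by (simp add: agree_def)
    then have "x = y" by auto
    then show False using y \<open>e > 0\<close> by simp
  qed
  then obtain M where M: "\<And>x y. x \<in> Sigma_shift k \<Longrightarrow> y \<in> Sigma_shift k \<Longrightarrow> agree (M x) x y \<Longrightarrow> \<bar>\<phi> x - \<phi> y\<bar> < e / 2"
    by metis
  have "\<exists>T. open T \<and> {y \<in> Sigma_shift k. agree (M x) x y} = Sigma_shift k \<inter> T" for x
  proof -
    have "window_local k (M x) (agree (M x) x)"
      by (auto simp: window_local_def agree_def)
    from openin_local_set[OF window_local_preimage[OF this, of "{True}"]]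
    show ?thesis by (auto simp: openin_open)
  qed
  then obtain T where T: "\<And>x. open (T x)" "\<And>x. {y \<in> Sigma_shift k. agree (M x) x y} = Sigma_shift k \<inter> T x"
    by metis
  have "Sigma_shift k \<subseteq> (\<Union>x\<in>Sigma_shift k. T x)"
    using T(2) agree_refl by blast
  from compactE_image[OF compact_Sigma_shift T(1) this] obtain X where
    X: "X \<subseteq> Sigma_shift k" "finite X" "Sigma_shift k \<subseteq> (\<Union>x\<in>X. T x)" by metis
  define m where "m = Max (insert 0 (M ` X))"
  show ?thesis
  proof (rule that)
    fix x y assume xy: "x \<in> Sigma_shift k" "y \<in> Sigma_shift k" "agree m x y"
    obtain z where z: "z \<in> X" "x \<in> T z" using X xy by blast
    then have zx: "agree (M z) z x" using T(2)[of z] xy by blast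
    have "agree (M z) x y" using z X unfolding m_def by (intro agree_mono[OF xy(3)[unfolded m_def]]) simp
    with zx have zy: "agree (M z) z y" by (simp add: agree_def)
    have "\<bar>\<phi> z - \<phi> x\<bar> < e / 2" "\<bar>\<phi> z - \<phi> y\<bar> < e / 2"
      using M zx zy z X xy by blast+
    then show "\<bar>\<phi> x - \<phi> y\<bar> < e" by linarith
  qed
qed

text \<open>Truncating the argument of \<open>\<phi>\<close> changes its integral by at most
  \<open>e\<close> for every probability measure at once, and the integral of the truncated function
  is a finite combination of measures of local sets.\<close>

lemma weak_star_convergesI_local:
  assumes \<mu>: "\<And>n. prob_space (\<mu> n)" "\<And>n. sets (\<mu> n) = sets (Sigma_borel k)"
    and \<nu>: "prob_space \<nu>" "sets \<nu> = sets (Sigma_borel k)"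
    and lim: "\<And>C. C \<in> local_sets k \<Longrightarrow> (\<lambda>n. measure (\<mu> n) C) \<longlonglongrightarrow> measure \<nu> C"
  shows "weak_star_converges k \<mu> \<nu>"
  unfolding weak_star_converges_def
proof (intro allI impI)
  fix \<phi> :: "(int \<Rightarrow> nat) \<Rightarrow> real"
  assume \<phi>: "continuous_on (Sigma_shift k) \<phi>"
  have "bounded (\<phi> ` Sigma_shift k)"
    by (intro compact_imp_bounded compact_continuous_image \<phi> compact_Sigma_shift)
  then obtain B where B: "\<And>x. x \<in> Sigma_shift k \<Longrightarrow> \<bar>\<phi> x\<bar> \<le> B"
    by (auto simp: bounded_iff)
  have meas: "\<phi> \<in> borel_measurable M" if "sets M = sets (Sigma_borel k)" for M
    using borel_measurable_continuous_on_restrict[OF \<phi>] that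
    unfolding Sigma_borel_def by (simp cong: measurable_cong_sets)
  show "(\<lambda>n. \<integral>\<xi>. \<phi> \<xi> \<partial>\<mu> n) \<longlonglongrightarrow> (\<integral>\<xi>. \<phi> \<xi> \<partial>\<nu>)"
  proof (rule LIMSEQ_I)
    fix r :: real assume "r > 0"
    \<comment> \<open>Two truncation errors and one convergence error add up to at most
      \<open>3 * e\<close>, which is below \<open>r\<close>.\<close>
    define e where "e = r / 4"
    have "e > 0" using \<open>r > 0\<close> by (simp add: e_def)
    from continuous_on_Sigma_shift_uniform[OF \<phi> this] obtain m
      where m: "\<And>x y. x \<in> Sigma_shift k \<Longrightarrow> y \<in> Sigma_shift k \<Longrightarrow> agree m x y \<Longrightarrow> \<bar>\<phi> x - \<phi> y\<bar> < e"
      by metis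
    let ?F = "\<lambda>x. \<phi> (truncate m x)"
    have F: "window_local k m ?F"
      unfolding window_local_def using truncate_cong by metis
    have close: "\<bar>(\<integral>x. \<phi> x \<partial>M) - (\<integral>x. ?F x \<partial>M)\<bar> \<le> e" if "prob_space M" "sets M = sets (Sigma_borel k)" for M
    proof -
      interpret prob_space M by fact
      have sp: "space M = Sigma_shift k" using sets_eq_imp_space_eq[OF that(2)] by simp
      have int: "integrable M \<phi>" "integrable M ?F"
        using B meas[OF that(2)] window_local_integral(1)[OF F finite_measure_axioms that(2)]
        by (auto intro!: integrable_const_bound[where B=B] simp: sp)
      have "\<bar>(\<integral>x. \<phi> x \<partial>M) - (\<integral>x. ?F x \<partial>M)\<bar> = \<bar>\<integral>x. \<phi> x - ?F x \<partial>M\<bar>"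
        using int by simp
      also have "\<dots> \<le> (\<integral>x. \<bar>\<phi> x - ?F x\<bar> \<partial>M)" by (rule integral_abs_bound)
      also have "\<dots> \<le> (\<integral>x. e \<partial>M)"
        using int m[OF _ truncate_Sigma_shift agree_truncate]
        by (intro integral_mono) (auto simp: sp intro: less_imp_le)
      finally show ?thesis by (simp add: prob_space)
    qed
    have "(\<lambda>n. \<integral>x. ?F x \<partial>\<mu> n) \<longlonglongrightarrow> (\<integral>x. ?F x \<partial>\<nu>)"
    proof -
      have fm: "finite_measure (\<mu> n)" "finite_measure \<nu>" for n
        using \<mu>(1) \<nu>(1) by (simp_all add: prob_space.finite_measure)
      have "{x \<in> Sigma_shift k. ?F x = v} \<in> local_sets k" for v
        using window_local_preimage[OF F, of "{v}"] by simp
      then show ?thesis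
        unfolding window_local_integral(2)[OF F fm(1) \<mu>(2)] window_local_integral(2)[OF F fm(2) \<nu>(2)]
        by (intro tendsto_intros lim)
    qed
    from LIMSEQ_D[OF this \<open>e > 0\<close>] obtain N
      where N: "\<And>n. n \<ge> N \<Longrightarrow> \<bar>(\<integral>x. ?F x \<partial>\<mu> n) - (\<integral>x. ?F x \<partial>\<nu>)\<bar> < e" by auto
    have "norm ((\<integral>x. \<phi> x \<partial>\<mu> n) - (\<integral>x. \<phi> x \<partial>\<nu>)) < r" if "n \<ge> N" for n
      using N[OF that] close[OF \<mu>(1,2), of n] close[OF \<nu>] \<open>r > 0\<close> unfolding e_def real_norm_def by linarith
    then show "\<exists>no. \<forall>n\<ge>no. norm ((\<integral>x. \<phi> x \<partial>\<mu> n) - (\<integral>x. \<phi> x \<partial>\<nu>)) < r" by blast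
  qed
qed

text \<open>
  By compactness a decreasing sequence of local sets with empty intersection is eventually
  empty, so the limit content on the algebra of local sets extends to a measure.
\<close>

lemma limit_measure_exists:
  assumes \<mu>: "\<And>n. prob_space (\<mu> n)" "\<And>n. sets (\<mu> n) = sets (Sigma_borel k)"
    and conv: "\<And>C. C \<in> local_sets k \<Longrightarrow> convergent (\<lambda>n. measure (\<mu> n) C)"
  obtains \<nu> where "prob_space \<nu>" "sets \<nu> = sets (Sigma_borel k)"
    "\<And>C. C \<in> local_sets k \<Longrightarrow> (\<lambda>n. measure (\<mu> n) C) \<longlonglongrightarrow> measure \<nu> C"
proof -
  interpret A: algebra "Sigma_shift k" "local_sets k" by (rule algebra_local_sets)
  define c where "c C = lim (\<lambda>n. measure (\<mu> n) C)" for C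
  have c: "(\<lambda>n. measure (\<mu> n) C) \<longlonglongrightarrow> c C" if "C \<in> local_sets k" for C
    using conv[OF that] by (simp add: c_def convergent_LIMSEQ_iff)
  have c_nonneg: "c C \<ge> 0" if "C \<in> local_sets k" for C
    using c[OF that] by (rule LIMSEQ_le_const) simp
  have c_empty: "c {} = 0" using c[of "{}"] by (simp add: LIMSEQ_const_iff)
  have c_space: "c (Sigma_shift k) = 1"
  proof -
    have "measure (\<mu> n) (Sigma_shift k) = 1" for n
      using prob_space.prob_space[OF \<mu>(1), of n] sets_eq_imp_space_eq[OF \<mu>(2)] by simp
    then show ?thesis using c[OF A.top] by (simp add: LIMSEQ_const_iff)
  qed
  have c_add: "c (C \<union> D) = c C + c D" if CD: "C \<in> local_sets k" "D \<in> local_sets k" "C \<inter> D = {}" for C D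
  proof -
    have "measure (\<mu> n) (C \<union> D) = measure (\<mu> n) C + measure (\<mu> n) D" for n
      using CD \<mu>(2) local_sets_measurable
      by (intro finite_measure.finite_measure_Union prob_space.finite_measure \<mu>(1)) auto
    then have "(\<lambda>n. measure (\<mu> n) (C \<union> D)) \<longlonglongrightarrow> c C + c D"
      using tendsto_add[OF c[OF CD(1)] c[OF CD(2)]] by simp
    then show ?thesis using c[of "C \<union> D"] CD LIMSEQ_unique by blast
  qed
  have "\<exists>\<mu>' :: _ \<Rightarrow> ennreal. (\<forall>s\<in>local_sets k. \<mu>' s = ennreal (c s)) \<and>
      measure_space (Sigma_shift k) (sigma_sets (Sigma_shift k) (local_sets k)) \<mu>'"
  proof (rule A.caratheodory_empty_continuous)
    show "positive (local_sets k) (\<lambda>s. ennreal (c s))" by (simp add: positive_def c_empty)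
    show "additive (local_sets k) (\<lambda>s. ennreal (c s))"
      by (auto simp: additive_def c_add c_nonneg simp flip: ennreal_plus)
    fix A :: "nat \<Rightarrow> (int \<Rightarrow> nat) set"
    assume A: "range A \<subseteq> local_sets k" "decseq A" "(\<Inter>i. A i) = {}"
    have "\<exists>n. A n = {}"
    proof (rule ccontr)
      assume *: "\<not> ?thesis"
      have "Sigma_shift k \<inter> (\<Inter>i\<in>UNIV. A i) \<noteq> {}"
      proof (rule compact_imp_fip_image[OF compact_Sigma_shift])
        show "closed (A i)" for i using A by (intro closed_local_set[of _ k]) auto
        fix I :: "nat set" assume I: "finite I"
        obtain x where x: "x \<in> A (Max (insert 0 I))" using * by blast
        have "A (Max (insert 0 I)) \<subseteq> A i" if "i \<in> I" for i
          using that I by (intro decseqD[OF A(2)]) simp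
        moreover have "A (Max (insert 0 I)) \<subseteq> Sigma_shift k"
          using A(1) A.space_closed by blast
        ultimately show "Sigma_shift k \<inter> (\<Inter>i\<in>I. A i) \<noteq> {}" using x by blast
      qed
      then show False using A by simp
    qed
    then obtain n where "A n = {}" by blast
    then have "A i = {}" if "i \<ge> n" for i using decseqD[OF A(2) that] by auto
    then have "\<forall>\<^sub>F i in sequentially. ennreal (c (A i)) = 0"
      by (auto simp: eventually_sequentially c_empty intro!: exI[of _ n])
    then show "(\<lambda>i. ennreal (c (A i))) \<longlonglongrightarrow> 0" by (simp add: tendsto_eventually)
  qed simp
  then obtain \<mu>' :: "_ \<Rightarrow> ennreal" where \<mu>': "\<And>s. s \<in> local_sets k \<Longrightarrow> \<mu>' s = ennreal (c s)"
    "measure_space (Sigma_shift k) (sigma_sets (Sigma_shift k) (local_sets k)) \<mu>'" by blast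
  define \<nu> where "\<nu> = measure_of (Sigma_shift k) (local_sets k) \<mu>'"
  have sets_\<nu>: "sets \<nu> = sets (Sigma_borel k)"
    unfolding \<nu>_def sets_Sigma_borel using A.space_closed by simp
  have em: "emeasure \<nu> C = ennreal (c C)" if "C \<in> local_sets k" for C
    using that \<mu>'(2) A.space_closed
    by (subst emeasure_measure_of[OF \<nu>_def]) (auto simp: \<nu>_def measure_space_def \<mu>')
  have "prob_space \<nu>"
    using em[OF A.top] sets_eq_imp_space_eq[OF sets_\<nu>] by (intro prob_spaceI) (simp add: c_space)
  moreover have "measure \<nu> C = c C" if "C \<in> local_sets k" for C
    using em[OF that] c_nonneg[OF that] by (simp add: measure_def)
  ultimately show ?thesis using that sets_\<nu> c by metis
qed

text \<open>Complements leave the symmetric difference unchanged. For a countable disjoint union,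
  all but finitely many pieces are dropped at cost \<open>e / 2\<close>, and the remaining ones are
  approximated one by one at total cost \<open>e / 2\<close>.\<close>

lemma (in finite_measure) approx_by_algebra:
  assumes "algebra (space M) G" and G: "sets M = sigma_sets (space M) G"
    and "A \<in> sets M" "e > 0"
  shows "\<exists>C\<in>G. measure M ((A - C) \<union> (C - A)) < e"
proof -
  interpret G: algebra "space M" G by fact
  have GM: "C \<in> sets M" if "C \<in> G" for C using that G by auto
  from assms(3) have "A \<in> sigma_sets (space M) G" using G by simp
  from G.Int_stable G.space_closed this \<open>e > 0\<close> show ?thesis
  proof (induction arbitrary: e rule: sigma_sets_induct_disjoint)
    case (basic A) then show ?case by (intro bexI[of _ A]) auto
  next
    case empty then show ?case by (intro bexI[of _ "{}"]) auto
  next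
    case (compl A)
    from compl(2)[OF compl(3)] obtain C where C: "C \<in> G" "measure M ((A - C) \<union> (C - A)) < e" by blast
    have "A \<in> sets M" using compl G by simp
    then have "((space M - A) - (space M - C)) \<union> ((space M - C) - (space M - A)) = (A - C) \<union> (C - A)"
      using sets.sets_into_space C G.space_closed by blast
    then show ?case using C by (intro bexI[of _ "space M - C"]) auto
  next
    case (union A)
    have A: "range A \<subseteq> sets M" using union G by simp
    have "(\<lambda>n. \<Sum>i<n. measure M (A i)) \<longlonglongrightarrow> measure M (\<Union>i. A i)"
      using finite_measure_UNION[OF A union(1)] by (simp add: sums_def)
    from LIMSEQ_D[OF this, of "e / 2"] obtain n where
      n: "\<bar>(\<Sum>i<n. measure M (A i)) - measure M (\<Union>i. A i)\<bar> < e / 2"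
      using \<open>e > 0\<close> by auto
    have fin: "(\<Sum>i<n. measure M (A i)) = measure M (\<Union>i<n. A i)"
      using A union(1) by (intro finite_measure_finite_Union[symmetric]) (auto simp: disjoint_family_on_def)
    \<comment> \<open>\<open>n\<close> pieces at this price cost at most \<open>e / 2\<close>;
      \<open>Suc n\<close> keeps the denominator positive when \<open>n = 0\<close>.\<close>
    let ?d = "e / (2 * real (Suc n))"
    have "?d > 0" using \<open>e > 0\<close> by simp
    then have "\<forall>i. \<exists>C\<in>G. measure M ((A i - C) \<union> (C - A i)) < ?d"
      using union(3) by blast
    then obtain C where C: "\<And>i. C i \<in> G" "\<And>i. measure M ((A i - C i) \<union> (C i - A i)) < ?d"
      by metis
    let ?S = "\<lambda>i. (A i - C i) \<union> (C i - A i)"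
    let ?U = "\<Union>i. A i" and ?V = "\<Union>i<n. C i"
    have S: "?S i \<in> sets M" for i using A C GM by blast
    have U: "?U \<in> sets M" "(\<Union>i<n. A i) \<in> sets M" using A by auto
    have "measure M ((?U - ?V) \<union> (?V - ?U)) \<le> measure M ((?U - (\<Union>i<n. A i)) \<union> (\<Union>i<n. ?S i))"
      using S U by (intro finite_measure_mono) auto
    also have "\<dots> \<le> measure M (?U - (\<Union>i<n. A i)) + measure M (\<Union>i<n. ?S i)"
      using S U by (intro measure_Un_le) auto
    also have "measure M (?U - (\<Union>i<n. A i)) = measure M ?U - measure M (\<Union>i<n. A i)"
      using U by (intro finite_measure_Diff) auto
    also have "measure M (\<Union>i<n. ?S i) \<le> (\<Sum>i<n. measure M (?S i))"
      using S by (intro finite_measure_subadditive_finite) auto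
    also have "\<dots> \<le> (\<Sum>i<n. ?d)" using C(2) by (intro sum_mono less_imp_le)
    also have "\<dots> \<le> e / 2" using \<open>e > 0\<close> by (simp add: field_simps)
    finally have "measure M ((?U - ?V) \<union> (?V - ?U)) < e" using n fin by linarith
    moreover have "?V \<in> G" using C by auto
    ultimately show ?case by blast
  qed
qed

section \<open>Spaced copies of a word\<close>

text \<open>A condition on neighbouring labels that forces every copy to be complete. Being local,
  it survives concatenation and cyclic reading, so no parsing into blocks is ever needed.\<close>

definition spacer_step :: "nat \<Rightarrow> nat option \<Rightarrow> nat option \<Rightarrow> bool" where
  "spacer_step L s t \<longleftrightarrow>
     (case s of None \<Rightarrow> t = None \<or> t = Some 0
      | Some p \<Rightarrow> if Suc p < L then t = Some (Suc p) else t = None \<or> t = Some 0)"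

text \<open>
  The letters of \<open>v\<close> carry labels: \<open>Some p\<close> for the \<open>p\<close>-th letter of a complete copy of \<open>u\<close>,
  \<open>None\<close> for a spacer between copies.
\<close>

definition spaced_copies :: "nat list \<Rightarrow> nat option list \<Rightarrow> nat list \<Rightarrow> bool" where
  "spaced_copies u W v \<longleftrightarrow>
     list_all2 (\<lambda>s c. \<forall>p. s = Some p \<longrightarrow> p < length u \<and> c = u ! p) W v \<and>
     successively (spacer_step (length u)) W \<and>
     W \<noteq> [] \<and> hd W = Some 0 \<and> (last W = None \<or> last W = Some (length u - 1))"

lemma spaced_copies_refl:
  assumes "u \<noteq> []"
  shows "spaced_copies u (map Some [0..<length u]) u"
proof -
  have "successively (spacer_step (length u)) (map Some [0..<length u])"
    by (auto simp: successively_conv_nth spacer_step_def)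
  then show ?thesis
    using assms unfolding spaced_copies_def
    by (auto simp: list_all2_conv_all_nth hd_map last_map)
qed

lemma spaced_copies_append:
  assumes u: "u \<noteq> []" and W: "spaced_copies u W v" "spaced_copies u W' v'"
  shows "spaced_copies u (W @ W') (v @ v')"
proof -
  have "spacer_step (length u) (last W) (hd W')"
    using u W by (auto simp: spaced_copies_def spacer_step_def)
  then show ?thesis
    using W unfolding spaced_copies_def
    by (auto simp: successively_append_iff intro!: list_all2_appendI)
qed

lemma spaced_copies_power:
  assumes u: "u \<noteq> []" and W: "spaced_copies u W v"
  shows "spaced_copies u (concat (replicate (Suc K) W)) (concat (replicate (Suc K) v))"
proof (induction K)
  case 0 then show ?case using W by simp
next
  case (Suc K)
  from spaced_copies_append[OF u W this] show ?case by simp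
qed

lemma spaced_copies_snoc_spacer:
  assumes "spaced_copies u W v"
  shows "spaced_copies u (W @ [None]) (v @ [c])"
proof -
  have "spacer_step (length u) (last W) None"
    using assms by (auto simp: spaced_copies_def spacer_step_def)
  then show ?thesis
    using assms unfolding spaced_copies_def
    by (auto simp: successively_append_iff intro!: list_all2_appendI)
qed

lemma spaced_copies_spacers:
  assumes "spaced_copies u W v"
  shows "spaced_copies u (W @ replicate (length s) None) (v @ s)"
proof (induction s rule: rev_induct)
  case Nil then show ?case using assms by simp
next
  case (snoc c s)
  from spaced_copies_snoc_spacer[OF this, of c] show ?case by (simp add: replicate_append_same)
qed

lemma count_list_concat_replicate:
  "count_list (concat (replicate n xs)) x = n * count_list xs x"
  by (induction n) auto

definition cyclic_nth :: "'a list \<Rightarrow> nat \<Rightarrow> 'a" where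
  "cyclic_nth xs j = xs ! (j mod length xs)"

text \<open>The conditions on \<open>hd W\<close> and \<open>last W\<close> are exactly what makes
  the step from the end of \<open>W\<close> back to its beginning legal, so the labels extend to the
  periodic repetition.\<close>

lemma spaced_copies_cyclic_step:
  assumes "u \<noteq> []" "spaced_copies u W v"
  shows "spacer_step (length u) (cyclic_nth W j) (cyclic_nth W (Suc j))"
proof -
  note W = assms(2)[unfolded spaced_copies_def]
  have len: "length W > 0" using W by simp
  show ?thesis
  proof (cases "Suc (j mod length W) = length W")
    case True
    then have "j mod length W = length W - 1" "Suc j mod length W = 0"
      by (simp_all add: mod_Suc)
    then have "cyclic_nth W j = last W" "cyclic_nth W (Suc j) = hd W"
      using len by (simp_all add: cyclic_nth_def last_conv_nth hd_conv_nth)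
    then show ?thesis using W assms(1) by (auto simp: spacer_step_def)
  next
    case False
    then have "Suc (j mod length W) < length W" using len by (simp add: Suc_lessI)
    moreover from False have "Suc j mod length W = Suc (j mod length W)" by (simp add: mod_Suc)
    ultimately show ?thesis
      using W by (simp add: cyclic_nth_def successively_conv_nth)
  qed
qed

lemma spaced_copies_cyclic_letter:
  assumes "spaced_copies u W v" "cyclic_nth W j = Some p"
  shows "p < length u" "cyclic_nth v j = u ! p"
proof -
  have W: "list_all2 (\<lambda>s c. \<forall>p. s = Some p \<longrightarrow> p < length u \<and> c = u ! p) W v" "W \<noteq> []"
    using assms(1) by (simp_all add: spaced_copies_def)
  then have "length W = length v" "j mod length W < length W"
    by (auto dest: list_all2_lengthD)
  then show "p < length u" "cyclic_nth v j = u ! p"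
    using list_all2_nthD[OF W(1), of "j mod length W"] assms(2) by (simp_all add: cyclic_nth_def)
qed

section \<open>Windows of a labelled sequence and their gluing\<close>

lemma spacer_run:
  assumes "\<And>j. spacer_step L (\<theta> j) (\<theta> (Suc j))" "\<theta> j = Some p" "p + i < L"
  shows "\<theta> (j + i) = Some (p + i)"
  using assms(3)
proof (induction i)
  case (Suc i)
  then have "\<theta> (j + i) = Some (p + i)" by simp
  then show ?case using assms(1)[of "j + i"] Suc.prems by (simp add: spacer_step_def)
qed (use assms(2) in simp)

text \<open>A window as long as the word meets at most two copies. Here \<open>a\<close> is the
  remaining length of the copy in progress at \<open>l\<close>, and \<open>b\<close> is the length
  left once the next copy begins; that copy cannot end before the window does.\<close>

lemma spacer_window:
  assumes step: "\<And>j. spacer_step L (\<theta> j) (\<theta> (Suc j))" and lt: "\<And>j p. \<theta> j = Some p \<Longrightarrow> p < L"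
  obtains a b where "a + b \<le> L"
    "\<And>i. i < a \<Longrightarrow> \<theta> (l + i) = Some (L - a + i)"
    "\<And>i. a \<le> i \<Longrightarrow> i < L - b \<Longrightarrow> \<theta> (l + i) = None"
    "\<And>i. L - b \<le> i \<Longrightarrow> i < L \<Longrightarrow> \<theta> (l + i) = Some (i - (L - b))"
proof -
  define a where "a = (case \<theta> l of None \<Rightarrow> 0 | Some p \<Rightarrow> L - p)"
  have a_le: "a \<le> L" by (auto simp: a_def split: option.split)
  have start: "\<theta> (l + i) = Some (L - a + i)" if "i < a" for i
  proof (cases "\<theta> l")
    case None then show ?thesis using that by (simp add: a_def)
  next
    case (Some p)
    have "p < L" by (rule lt[OF Some])
    then have "L - a = p" by (simp add: a_def Some)
    then show ?thesis using that spacer_run[OF step Some, of i] by (simp add: a_def Some)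
  qed
  have next_a: "\<theta> (l + a) = None \<or> \<theta> (l + a) = Some 0"
  proof (cases a)
    case 0
    then have "\<theta> l = None" using lt[of l] by (cases "\<theta> l") (simp_all add: a_def leD)
    then show ?thesis using 0 by simp
  next
    case (Suc a')
    then have "\<theta> (l + a') = Some (L - 1)" using start[of a'] a_le by simp
    then show ?thesis using step[of "l + a'"] Suc a_le by (simp add: spacer_step_def)
  qed
  \<comment> \<open>The alternative \<open>i = L\<close> guarantees a least element when no copy
    begins inside the window; then \<open>b = 0\<close>.\<close>
  define Q where "Q i \<longleftrightarrow> a \<le> i \<and> (\<theta> (l + i) \<noteq> None \<or> i = L)" for i
  define t where "t = Least Q"
  have "Q L" using a_le by (simp add: Q_def)
  then have "Q t" and t_le: "t \<le> L" unfolding t_def by (rule LeastI, rule Least_le)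
  then have t: "a \<le> t \<and> (\<theta> (l + t) \<noteq> None \<or> t = L)" by (simp add: Q_def)
  have none: "\<theta> (l + i) = None" if "a \<le> i" "i < t" for i
  proof -
    have "\<not> Q i" using that(2) unfolding t_def by (rule not_less_Least)
    then show ?thesis using that(1) by (simp add: Q_def)
  qed
  have prefix: "\<theta> (l + i) = Some (i - t)" if "t \<le> i" "i < L" for i
  proof -
    have some: "\<theta> (l + t) \<noteq> None" using t that by linarith
    have "\<theta> (l + t) = Some 0"
    proof (cases "t = a")
      case True
      from next_a show ?thesis using some by (elim disjE) (simp_all add: True)
    next
      case False
      then have "a < t" using t by linarith
      then obtain d where d: "t = Suc (a + d)" using less_imp_Suc_add by blast
      have "\<theta> (l + (a + d)) = None" using none[of "a + d"] by (simp add: d)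
      then have "\<theta> (l + t) = None \<or> \<theta> (l + t) = Some 0"
        using step[of "l + (a + d)"] by (simp add: spacer_step_def d)
      then show ?thesis using some by blast
    qed
    from spacer_run[OF step this, of "i - t"] that show ?thesis by simp
  qed
  show ?thesis
    using t t_le start none prefix by (intro that[of a "L - t"]) auto
qed

text \<open>The suffix of length \<open>a\<close> and the prefix of length \<open>b\<close> go to
  their own places in the word. The spacers in between fill the uncovered positions
  \<open>b..<L - a\<close> in order; their letters need not fit, but they make the map a
  permutation.\<close>

definition glue_index :: "nat \<Rightarrow> nat \<Rightarrow> nat \<Rightarrow> nat \<Rightarrow> nat" where
  "glue_index L a b i =
     (if i < a then L - a + i else if i < L - b then i - a + b else i - (L - b))"

lemma bij_betw_glue_index:
  assumes "a + b \<le> L"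
  shows "bij_betw (glue_index L a b) {..<L} {..<L}"
proof (rule bij_betwI')
  fix i j assume "i \<in> {..<L}" "j \<in> {..<L}"
  then show "(glue_index L a b i = glue_index L a b j) = (i = j)"
    using assms by (auto simp: glue_index_def split: if_splits)
next
  fix i assume "i \<in> {..<L}"
  then show "glue_index L a b i \<in> {..<L}"
    using assms by (auto simp: glue_index_def)
next
  fix j assume j: "j \<in> {..<L}"
  \<comment> \<open>The inverse is the same map with \<open>a\<close> and \<open>b\<close>
    exchanged.\<close>
  define i where "i = (if j < b then L - b + j else if j < L - a then j - b + a else j - (L - a))"
  have "i < L \<and> j = glue_index L a b i"
    using assms j by (auto simp: glue_index_def i_def)
  then show "\<exists>i\<in>{..<L}. j = glue_index L a b i" by auto
qed

text \<open>Neighbourhoods of radius \<open>m\<close> are compared instead of single letters, so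
  that a function local to that radius takes equal values at every position outside this
  set.\<close>

definition mismatches :: "nat \<Rightarrow> nat \<Rightarrow> (int \<Rightarrow> nat) \<Rightarrow> nat \<Rightarrow> nat \<Rightarrow> (int \<Rightarrow> nat) \<Rightarrow> nat set" where
  "mismatches m L y a b x =
     {i. i < L \<and> \<not> agree m ((shift_map ^^ i) x) ((shift_map ^^ glue_index L a b i) y)}"

definition glue_dist :: "nat \<Rightarrow> nat \<Rightarrow> (int \<Rightarrow> nat) \<Rightarrow> (int \<Rightarrow> nat) \<Rightarrow> nat" where
  "glue_dist m L y x = Min ((\<lambda>(a, b). card (mismatches m L y a b x)) ` {(a, b). a + b \<le> L})"

lemma finite_pairs_le: "finite {(a :: nat, b). a + b \<le> L}"
  by (rule finite_subset[of _ "{..L} \<times> {..L}"]) auto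

lemma glue_dist_le: "a + b \<le> L \<Longrightarrow> glue_dist m L y x \<le> card (mismatches m L y a b x)"
  unfolding glue_dist_def using finite_pairs_le by (intro Min_le) auto

lemma glue_dist_attained:
  obtains a b where "a + b \<le> L" "glue_dist m L y x = card (mismatches m L y a b x)"
proof -
  have "(0, 0) \<in> {(a, b). a + b \<le> L}" by simp
  then have "{(a, b). a + b \<le> L} \<noteq> {}" by blast
  then have "glue_dist m L y x \<in> (\<lambda>(a, b). card (mismatches m L y a b x)) ` {(a, b). a + b \<le> L}"
    unfolding glue_dist_def using finite_pairs_le by (intro Min_in) auto
  then show ?thesis using that by auto
qed

lemma agree_cong:
  assumes "agree m x x'"
  shows "agree m x z = agree m x' z"
  unfolding agree_def by (intro all_cong1 imp_cong refl) (simp only: agreeD[OF assms])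

lemma window_local_glue_dist: "window_local k (m + L) (\<lambda>x. real (glue_dist m L y x))"
proof (rule window_localI)
  fix x x' assume xx': "agree (m + L) x x'"
  then have "agree m ((shift_map ^^ i) x) ((shift_map ^^ i) x')" if "i < L" for i
    using that by (intro agree_shift agree_mono[OF xx']) simp
  then have "mismatches m L y a b x = mismatches m L y a b x'" for a b
    unfolding mismatches_def by (intro Collect_cong conj_cong refl arg_cong[where f=Not] agree_cong)
  then show "real (glue_dist m L y x) = real (glue_dist m L y x')"
    by (simp add: glue_dist_def)
qed

lemma generated_by_nat:
  assumes "generated_by x v"
  shows "x (int j) = cyclic_nth v j"
  using assms by (simp add: generated_by_def cyclic_nth_def flip: of_nat_mod)

lemma generated_by_periodic:
  assumes "generated_by x v"
  shows "(shift_map ^^ length v) x = x"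
  using assms by (intro ext) (simp add: generated_by_def shift_map_funpow)

text \<open>Take the split given by the labels. A position that is no spacer and lies at distance at
  least \<open>m\<close> from both ends of its piece has its whole neighbourhood inside that piece,
  where the letters are those of \<open>u\<close>. Two pieces have four ends, hence
  \<open>4 * m\<close>.\<close>

lemma glue_dist_spaced_copies:
  assumes u: "u \<noteq> []" and W: "spaced_copies u W v" and x: "generated_by x v" and y: "generated_by y u"
  shows "glue_dist m (length u) y ((shift_map ^^ l) x) \<le>
    4 * m + card {i. i < length u \<and> cyclic_nth W (l + i) = None}"
proof -
  let ?L = "length u"
  let ?\<theta> = "cyclic_nth W"
  obtain a b where ab: "a + b \<le> ?L"
    and pre: "\<And>i. i < a \<Longrightarrow> ?\<theta> (l + i) = Some (?L - a + i)"
    and mid: "\<And>i. a \<le> i \<Longrightarrow> i < ?L - b \<Longrightarrow> ?\<theta> (l + i) = None"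
    and suf: "\<And>i. ?L - b \<le> i \<Longrightarrow> i < ?L \<Longrightarrow> ?\<theta> (l + i) = Some (i - (?L - b))"
    using spacer_window[of ?L ?\<theta> l] spaced_copies_cyclic_step[OF u W] spaced_copies_cyclic_letter(1)[OF W]
    by metis
  have letter: "x (int (l + i)) = y (int p)" if "?\<theta> (l + i) = Some p" for i p
  proof -
    have "p < ?L" "cyclic_nth v (l + i) = u ! p" using spaced_copies_cyclic_letter[OF W that] by auto
    then show ?thesis
      unfolding generated_by_nat[OF x] generated_by_nat[OF y] by (simp add: cyclic_nth_def)
  qed
  let ?N = "{i. i < ?L \<and> ?\<theta> (l + i) = None}"
  \<comment> \<open>The spacers, followed by the margins at both ends of the suffix and at both ends
    of the prefix.\<close>
  let ?E = "?N \<union> ({..<m} \<union> {a - m..<a} \<union> {?L - b..<?L - b + m} \<union> {?L - m..<?L})"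
  have "mismatches m ?L y a b ((shift_map ^^ l) x) \<subseteq> ?E"
  proof
    fix i assume i: "i \<in> mismatches m ?L y a b ((shift_map ^^ l) x)"
    show "i \<in> ?E"
    proof (rule ccontr)
      assume nE: "i \<notin> ?E"
      have "i < ?L" using i by (simp add: mismatches_def)
      have "agree m ((shift_map ^^ i) ((shift_map ^^ l) x)) ((shift_map ^^ glue_index ?L a b i) y)"
        unfolding agree_def shift_map_funpow
      proof (intro allI impI)
        fix j :: int assume j: "\<bar>j\<bar> \<le> int m"
        \<comment> \<open>\<open>i\<close> avoids \<open>{..<m}\<close>, so \<open>int i + j\<close>
          is nonnegative and \<open>i'\<close> represents it exactly.\<close>
        define i' where "i' = nat (int i + j)"
        have i': "int i' = int i + j" using j nE unfolding i'_def by auto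
        have lhs: "j + int i + int l = int (l + i')" using i' by simp
        consider "i < a" | "?L - b \<le> i" using mid[of i] nE \<open>i < ?L\<close> by fastforce
        then show "x (j + int i + int l) = y (j + int (glue_index ?L a b i))"
        proof cases
          case 1
          have "i' < a" using 1 nE j i' by auto
          have "j + int (glue_index ?L a b i) = int (?L - a + i')"
            using 1 i' by (simp add: glue_index_def)
          then show ?thesis unfolding lhs using letter[OF pre[OF \<open>i' < a\<close>]] by simp
        next
          case 2
          have "?L - b \<le> i'" "i' < ?L" using 2 nE j i' \<open>i < ?L\<close> by auto
          moreover have "j + int (glue_index ?L a b i) = int (i' - (?L - b))"
            using 2 i' ab \<open>?L - b \<le> i'\<close> by (simp add: glue_index_def of_nat_diff)
          ultimately show ?thesis unfolding lhs using letter[OF suf] by simp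
        qed
      qed
      then show False using i by (simp add: mismatches_def)
    qed
  qed
  then have "card (mismatches m ?L y a b ((shift_map ^^ l) x)) \<le> card ?E"
    by (intro card_mono) auto
  also have "\<dots> \<le> card ?N + (card {..<m} + card {a - m..<a} + card {?L - b..<?L - b + m} + card {?L - m..<?L})"
    by (intro order_trans[OF card_Un_le] add_mono order_refl)
  also have "\<dots> \<le> card ?N + 4 * m" by simp
  finally show ?thesis using glue_dist_le[OF ab, of m y "(shift_map ^^ l) x"] by linarith
qed

lemma sum_periodic_shift:
  fixes f :: "nat \<Rightarrow> 'a :: ab_group_add"
  assumes "\<And>l. f (l + p) = f l"
  shows "(\<Sum>l<p. f (l + i)) = (\<Sum>l<p. f l)"
proof (induction i)
  case (Suc i)
  have "(\<Sum>l<p. f (l + Suc i)) + f i = (\<Sum>l<Suc p. f (l + i))"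
    by (subst sum.lessThan_Suc_shift) (simp add: add.commute)
  also have "\<dots> = (\<Sum>l<p. f (l + i)) + f i"
    using assms[of i] by (simp add: add.commute)
  finally show ?case using Suc by simp
qed simp

text \<open>Double counting: for each of the \<open>L\<close> offsets, the windows of one period run
  through every label of \<open>W\<close> exactly once.\<close>

lemma sum_card_spacers:
  assumes "W \<noteq> []"
  shows "(\<Sum>l<length W. real (card {i. i < L \<and> cyclic_nth W (l + i) = None})) = real L * real (count_list W None)"
proof -
  let ?f = "\<lambda>j. of_bool (cyclic_nth W j = None) :: real"
  have card: "real (card {i. i < L \<and> cyclic_nth W (l + i) = None}) = (\<Sum>i<L. ?f (l + i))" for l
    by (simp add: of_bool_def sum.If_cases Int_def lessThan_def)
  have "(\<Sum>l<length W. ?f (l + i)) = real (count_list W None)" for i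
  proof -
    have "(\<Sum>l<length W. ?f (l + i)) = (\<Sum>l<length W. ?f l)"
      by (rule sum_periodic_shift) (simp add: cyclic_nth_def)
    also have "\<dots> = real (card {l. l < length W \<and> W ! l = None})"
      by (simp add: of_bool_def sum.If_cases Int_def lessThan_def cyclic_nth_def cong: conj_cong)
    also have "\<dots> = real (count_list W None)"
      by (simp add: count_list_eq_length_filter length_filter_conv_card eq_commute)
    finally show ?thesis .
  qed
  then show ?thesis unfolding card by (subst sum.swap) simp
qed

section \<open>Orbit measures along a repetitive sequence of words\<close>

lemma measure_orbit_measure:
  assumes "A \<in> sets (Sigma_borel k)" "p > 0"
  shows "measure (orbit_measure k x p) A = (\<Sum>l<p. indicator A ((shift_map ^^ l) x)) / real p"
    and "emeasure (orbit_measure k x p) A = ennreal (measure (orbit_measure k x p) A)"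
proof -
  have "emeasure (orbit_measure k x p) A = (\<Sum>l<p. ennreal (indicat_real A ((shift_map ^^ l) x))) / ennreal (real p)"
    by (simp add: emeasure_orbit_measure[OF assms(1)] ennreal_of_nat_eq_real_of_nat ennreal_indicator)
  also have "\<dots> = ennreal ((\<Sum>l<p. indicat_real A ((shift_map ^^ l) x)) / real p)"
    using assms(2) by (subst sum_ennreal) (auto intro!: divide_ennreal sum_nonneg)
  finally have *: "emeasure (orbit_measure k x p) A = ennreal ((\<Sum>l<p. indicat_real A ((shift_map ^^ l) x)) / real p)" .
  then show "measure (orbit_measure k x p) A = (\<Sum>l<p. indicator A ((shift_map ^^ l) x)) / real p"
    by (simp add: measure_def sum_nonneg)
  with * show "emeasure (orbit_measure k x p) A = ennreal (measure (orbit_measure k x p) A)"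
    by simp
qed

lemma prob_space_orbit_measure:
  assumes "x \<in> Sigma_shift k" "p > 0"
  shows "prob_space (orbit_measure k x p)"
proof (rule prob_spaceI)
  have "Sigma_shift k \<in> sets (Sigma_borel k)" using sets.top[of "Sigma_borel k"] by simp
  then show "emeasure (orbit_measure k x p) (space (orbit_measure k x p)) = 1"
    using assms measure_orbit_measure[OF _ assms(2)] shift_map_Sigma_shift[OF assms(1)] by simp
qed

lemma integral_orbit_measure:
  fixes F :: "(int \<Rightarrow> nat) \<Rightarrow> real"
  assumes F: "window_local k m F" and x: "x \<in> Sigma_shift k" and p: "p > 0"
  shows "(\<integral>y. F y \<partial>orbit_measure k x p) = (\<Sum>l<p. F ((shift_map ^^ l) x)) / real p"
proof -
  interpret prob_space "orbit_measure k x p" by (rule prob_space_orbit_measure[OF x p])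
  let ?A = "\<lambda>v. {y \<in> Sigma_shift k. F y = v}"
  have A: "?A v \<in> sets (Sigma_borel k)" for v
    using local_sets_measurable[OF window_local_preimage[OF F, of "{v}"]] by simp
  have fin: "finite (F ` Sigma_shift k)" by (rule window_local_finite_image[OF F])
  have ind: "(\<Sum>v\<in>F ` Sigma_shift k. v * indicator (?A v) y) = F y" if "y \<in> Sigma_shift k" for y
  proof -
    have "(\<Sum>v\<in>F ` Sigma_shift k. v * indicator (?A v) y) = (\<Sum>v\<in>{F y}. v * indicator (?A v) y)"
      using that fin by (intro sum.mono_neutral_right) (auto simp: indicator_def)
    also have "\<dots> = F y" using that by simp
    finally show ?thesis .
  qed
  have "(\<integral>y. F y \<partial>orbit_measure k x p)
      = (\<Sum>v\<in>F ` Sigma_shift k. v * measure (orbit_measure k x p) (?A v))"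
    by (rule window_local_integral(2)[OF F finite_measure_axioms]) simp
  also have "\<dots> = (\<Sum>v\<in>F ` Sigma_shift k. \<Sum>l<p. v * indicator (?A v) ((shift_map ^^ l) x)) / real p"
    by (simp only: measure_orbit_measure(1)[OF A p] sum_distrib_left sum_divide_distrib times_divide_eq_right)
  also have "\<dots> = (\<Sum>l<p. F ((shift_map ^^ l) x)) / real p"
    by (subst sum.swap) (simp only: ind[OF shift_map_Sigma_shift[OF x]])
  finally show ?thesis .
qed

lemma window_local_indicator:
  assumes "window_local k m (\<lambda>x. x \<in> C)"
  shows "window_local k m (indicat_real C)"
proof (rule window_localI)
  fix x y assume "x \<in> Sigma_shift k" "y \<in> Sigma_shift k" "agree m x y"
  then have "(x \<in> C) = (y \<in> C)" by (rule window_localD[OF assms])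
  then show "indicat_real C x = indicat_real C y" by (simp add: indicator_def)
qed

lemma shift_map_measurable: "shift_map \<in> measurable (Sigma_borel k) (Sigma_borel k)"
proof (rule measurable_sigma_sets[where A="local_sets k" and \<Omega>="Sigma_shift k"])
  interpret algebra "Sigma_shift k" "local_sets k" by (rule algebra_local_sets)
  show "local_sets k \<subseteq> Pow (Sigma_shift k)" by (rule space_closed)
  show "shift_map \<in> space (Sigma_borel k) \<rightarrow> Sigma_shift k"
    using shift_map_Sigma_shift[of _ k 1] by simp
  fix C assume "C \<in> local_sets k"
  then obtain m where "window_local k m (\<lambda>x. x \<in> C)" unfolding local_sets_def by blast
  from window_local_preimage[OF window_local_shift[OF this, of 1], of "{True}"]
  show "shift_map -` C \<inter> space (Sigma_borel k) \<in> sets (Sigma_borel k)"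
    by (intro local_sets_measurable) (simp add: vimage_def Int_def conj_commute)
qed (rule sets_Sigma_borel)

section \<open>Estimates for the orbit measures, uniform in the later words\<close>

locale repetitive_words =
  fixes k :: nat and \<xi> :: "nat \<Rightarrow> int \<Rightarrow> nat" and w \<alpha> :: "nat \<Rightarrow> nat list" and K :: "nat \<Rightarrow> nat"
  assumes \<xi>: "\<xi> n \<in> Sigma_shift k"
    and gen: "generated_by (\<xi> n) (w n)"
    and word: "w (Suc n) = concat (replicate (K n) (w n)) @ \<alpha> n"
    and K: "K n \<ge> 1" and \<alpha>: "\<alpha> n \<noteq> []"
    and summ: "summable (\<lambda>n. real (length (\<alpha> n)) / (real (K n) * real (length (w n))))"
begin

definition per :: "nat \<Rightarrow> nat" where "per n = length (w n)"

definition ratio :: "nat \<Rightarrow> real" where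
  "ratio n = real (length (\<alpha> n)) / (real (K n) * real (per n))"

definition err :: "nat \<Rightarrow> real" where "err n = (\<Sum>i. ratio (i + n))"

abbreviation \<mu> :: "nat \<Rightarrow> (int \<Rightarrow> nat) measure" where
  "\<mu> n \<equiv> orbit_measure k (\<xi> n) (per n)"

lemma w_nonempty: "w n \<noteq> []"
  using gen[of n] by (simp add: generated_by_def)

lemma per_pos: "per n > 0"
  using w_nonempty by (simp add: per_def)

lemma per_Suc: "per (Suc n) = K n * per n + length (\<alpha> n)"
  by (simp add: per_def word length_concat sum_list_replicate)

lemma per_ge: "n \<le> per n"
proof (induction n)
  case (Suc n)
  have "1 * per n \<le> K n * per n" using K[of n] by (intro mult_right_mono) simp_all
  moreover have "length (\<alpha> n) \<ge> 1" using \<alpha>[of n] by (cases "\<alpha> n") simp_all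
  ultimately show ?case using Suc per_Suc[of n] by linarith
qed simp

lemma per_at_top: "filterlim (\<lambda>n. real (per n)) at_top sequentially"
  by (rule filterlim_at_top_mono[OF filterlim_real_sequentially]) (simp add: per_ge)

lemma ratio_nonneg: "ratio n \<ge> 0"
  by (simp add: ratio_def)

lemma summable_ratio: "summable ratio"
  using summ by (simp add: ratio_def[abs_def] per_def)

lemma err_tendsto: "err \<longlonglongrightarrow> 0"
proof (rule LIMSEQ_I)
  fix r :: real assume "r > 0"
  from suminf_exist_split[OF this summable_ratio]
  show "\<exists>no. \<forall>n\<ge>no. norm (err n - 0) < r" by (simp add: err_def)
qed

lemma sum_ratio_le_err: "(\<Sum>i<d. ratio (n + i)) \<le> err n"
  unfolding err_def add.commute[of n]
  by (intro sum_le_suminf summable_ignore_initial_segment summable_ratio) (auto simp: ratio_nonneg)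

text \<open>Each step repeats the old spacers \<open>K\<close> times, which does not raise their
  density, and labels all of \<open>\<alpha>\<close> as spacers, which adds \<open>ratio\<close>.
  The ratio is taken relative to \<open>K * per\<close>; passing to the longer new period only
  weakens the bound.\<close>

lemma spaced_copies_word:
  "\<exists>W. spaced_copies (w n) W (w (n + d)) \<and>
    real (count_list W None) \<le> real (per (n + d)) * (\<Sum>i<d. ratio (n + i))"
proof (induction d)
  case 0
  have "count_list (map Some [0..<length (w n)]) None = 0" by (auto simp: count_list_0_iff)
  with spaced_copies_refl[OF w_nonempty] show ?case
    by (intro exI[of _ "map Some [0..<length (w n)]"]) simp
next
  case (Suc d)
  then obtain W where W: "spaced_copies (w n) W (w (n + d))"
    and c: "real (count_list W None) \<le> real (per (n + d)) * (\<Sum>i<d. ratio (n + i))" by blast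
  let ?N = "n + d" and ?S = "\<Sum>i<d. ratio (n + i)"
  let ?W = "concat (replicate (K ?N) W) @ replicate (length (\<alpha> ?N)) None"
  have "K ?N = Suc (K ?N - 1)" using K[of ?N] by simp
  with spaced_copies_power[OF w_nonempty W, of "K ?N - 1"]
  have "spaced_copies (w n) (concat (replicate (K ?N) W)) (concat (replicate (K ?N) (w ?N)))" by simp
  from spaced_copies_spacers[OF this, of "\<alpha> ?N"]
  have "spaced_copies (w n) ?W (w (n + Suc d))" by (simp add: word)
  moreover have "real (count_list ?W None) \<le> real (per (n + Suc d)) * (\<Sum>i<Suc d. ratio (n + i))"
  proof -
    have "count_list (replicate r None) None = r" for r :: nat by (induction r) auto
    then have "real (count_list ?W None) = real (K ?N) * real (count_list W None) + real (length (\<alpha> ?N))"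
      by (simp add: count_list_concat_replicate)
    also have "real (length (\<alpha> ?N)) = real (K ?N) * real (per ?N) * ratio ?N"
      using K[of ?N] per_pos[of ?N] by (simp add: ratio_def)
    also have "real (K ?N) * real (count_list W None) \<le> real (K ?N) * (real (per ?N) * ?S)"
      using c by (intro mult_left_mono) simp_all
    also have "real (K ?N) * (real (per ?N) * ?S) + real (K ?N) * real (per ?N) * ratio ?N
        = (real (K ?N) * real (per ?N)) * (\<Sum>i<Suc d. ratio (n + i))"
      by (simp add: algebra_simps)
    also have "\<dots> \<le> real (per (n + Suc d)) * (\<Sum>i<Suc d. ratio (n + i))"
      using per_Suc[of ?N] by (intro mult_right_mono sum_nonneg ratio_nonneg) simp
    finally show ?thesis by simp
  qed
  ultimately show ?case by blast
qed

lemma prob_space_\<mu>: "prob_space (\<mu> n)"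
  by (rule prob_space_orbit_measure[OF \<xi> per_pos])

lemma integral_\<mu>:
  fixes F :: "(int \<Rightarrow> nat) \<Rightarrow> real"
  assumes "window_local k m F"
  shows "(\<integral>x. F x \<partial>\<mu> n) = (\<Sum>l<per n. F ((shift_map ^^ l) (\<xi> n))) / real (per n)"
  by (rule integral_orbit_measure[OF assms \<xi> per_pos])

lemma integral_indicator_\<mu>:
  "C \<in> sets (Sigma_borel k) \<Longrightarrow> (\<integral>x. indicat_real C x \<partial>\<mu> n) = measure (\<mu> n) C"
  using sets.sets_into_space[of C "Sigma_borel k"] by (simp add: Int_absorb2)

lemma periodic_\<xi>: "(shift_map ^^ (l + per n)) (\<xi> n) = (shift_map ^^ l) (\<xi> n)"
  using generated_by_periodic[OF gen[of n]] by (simp add: funpow_add per_def)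

text \<open>A window of length \<open>per n\<close> contains on average \<open>per n\<close> times
  the spacer density of \<open>w N\<close>. What matters is that the bound does not involve
  \<open>N\<close>.\<close>

lemma integral_glue_dist_le:
  assumes "n \<le> N"
  shows "(\<integral>x. real (glue_dist m (per n) (\<xi> n) x) \<partial>\<mu> N) \<le> real (per n) * err n + 4 * real m"
proof -
  obtain d where N: "N = n + d" using assms le_Suc_ex by blast
  obtain W where W: "spaced_copies (w n) W (w N)"
    and c: "real (count_list W None) \<le> real (per N) * (\<Sum>i<d. ratio (n + i))"
    using spaced_copies_word[of n d] N by auto
  have lenW: "length W = per N" "W \<noteq> []"
    using W list_all2_lengthD by (auto simp: spaced_copies_def per_def)
  let ?s = "\<lambda>l. real (card {i. i < per n \<and> cyclic_nth W (l + i) = None})"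
  have "(\<Sum>l<per N. real (glue_dist m (per n) (\<xi> n) ((shift_map ^^ l) (\<xi> N))))
      \<le> (\<Sum>l<per N. 4 * real m + ?s l)"
  proof (rule sum_mono)
    fix l
    have "glue_dist m (per n) (\<xi> n) ((shift_map ^^ l) (\<xi> N))
        \<le> 4 * m + card {i. i < per n \<and> cyclic_nth W (l + i) = None}"
      unfolding per_def by (rule glue_dist_spaced_copies[OF w_nonempty W gen gen])
    then show "real (glue_dist m (per n) (\<xi> n) ((shift_map ^^ l) (\<xi> N))) \<le> 4 * real m + ?s l"
      by linarith
  qed
  also have "\<dots> = 4 * real m * real (per N) + real (per n) * real (count_list W None)"
    using sum_card_spacers[OF lenW(2), of "per n"] lenW(1) by (simp add: sum.distrib)
  also have "\<dots> \<le> 4 * real m * real (per N) + real (per n) * (real (per N) * err n)"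
    using order_trans[OF c mult_left_mono[OF sum_ratio_le_err]] by (intro add_left_mono mult_left_mono) simp_all
  also have "\<dots> = (real (per n) * err n + 4 * real m) * real (per N)"
    by (simp add: algebra_simps)
  finally show ?thesis
    unfolding integral_\<mu>[OF window_local_glue_dist] using per_pos[of N] by (simp add: divide_le_eq)
qed

text \<open>Summed along the glued positions, the indicator gives exactly
  \<open>per n * measure (\<mu> n) C\<close>, because gluing permutes the positions of one period;
  each mismatch changes the sum by at most 1.\<close>

lemma average_glue_dist:
  assumes C: "window_local k m (\<lambda>x. x \<in> C)" "C \<in> sets (Sigma_borel k)" and x: "x \<in> Sigma_shift k"
  shows "\<bar>(\<Sum>i<per n. indicator C ((shift_map ^^ i) x)) / real (per n) - measure (\<mu> n) C\<bar>
    \<le> real (glue_dist m (per n) (\<xi> n) x) / real (per n)"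
proof -
  let ?L = "per n"
  obtain a b where ab: "a + b \<le> ?L" "glue_dist m ?L (\<xi> n) x = card (mismatches m ?L (\<xi> n) a b x)"
    by (rule glue_dist_attained)
  let ?M = "mismatches m ?L (\<xi> n) a b x"
  let ?f = "\<lambda>i. indicat_real C ((shift_map ^^ i) x)"
  let ?g = "\<lambda>i. indicat_real C ((shift_map ^^ i) (\<xi> n))"
  have M: "?M \<subseteq> {..<?L}" by (auto simp: mismatches_def)
  have "(\<Sum>i<?L. ?g (glue_index ?L a b i)) = (\<Sum>i<?L. ?g i)"
    using sum.reindex_bij_betw[OF bij_betw_glue_index[OF ab(1)], of ?g] .
  then have g: "(\<Sum>i<?L. ?g (glue_index ?L a b i)) = real ?L * measure (\<mu> n) C"
    using measure_orbit_measure(1)[OF C(2) per_pos] per_pos[of n] by simp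
  have "\<bar>?f i - ?g (glue_index ?L a b i)\<bar> \<le> of_bool (i \<in> ?M)" if i: "i < ?L" for i
  proof (cases "i \<in> ?M")
    case True then show ?thesis by (auto simp: indicator_def)
  next
    case False
    then have "agree m ((shift_map ^^ i) x) ((shift_map ^^ glue_index ?L a b i) (\<xi> n))"
      using i by (simp add: mismatches_def)
    from window_localD[OF window_local_indicator[OF C(1)] shift_map_Sigma_shift[OF x] shift_map_Sigma_shift[OF \<xi>] this]
    show ?thesis by simp
  qed
  then have "\<bar>\<Sum>i<?L. ?f i - ?g (glue_index ?L a b i)\<bar> \<le> (\<Sum>i<?L. of_bool (i \<in> ?M))"
    by (intro order_trans[OF sum_abs] sum_mono) simp
  also have "\<dots> = real (card ?M)"
    using M by (simp add: of_bool_def sum.If_cases Int_absorb1 flip: Int_def)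
  finally have "\<bar>(\<Sum>i<?L. ?f i) - real ?L * measure (\<mu> n) C\<bar> \<le> real (glue_dist m ?L (\<xi> n) x)"
    by (simp add: sum_subtractf g ab(2))
  then have "\<bar>(\<Sum>i<?L. ?f i) - real ?L * measure (\<mu> n) C\<bar> / real ?L \<le> real (glue_dist m ?L (\<xi> n) x) / real ?L"
    by (intro divide_right_mono) simp_all
  moreover have "\<bar>(\<Sum>i<?L. ?f i) - real ?L * measure (\<mu> n) C\<bar> / real ?L
      = \<bar>(\<Sum>i<?L. ?f i) / real ?L - measure (\<mu> n) C\<bar>"
  proof -
    have "(\<Sum>i<?L. ?f i) / real ?L - measure (\<mu> n) C = ((\<Sum>i<?L. ?f i) - real ?L * measure (\<mu> n) C) / real ?L"
      using per_pos[of n] by (simp add: diff_divide_distrib)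
    then show ?thesis by (simp add: abs_divide)
  qed
  ultimately show ?thesis by simp
qed

lemma integral_\<mu>_shift:
  fixes F :: "(int \<Rightarrow> nat) \<Rightarrow> real"
  assumes "window_local k m F"
  shows "(\<integral>x. F ((shift_map ^^ i) x) \<partial>\<mu> n) = (\<integral>x. F x \<partial>\<mu> n)"
proof -
  have "(\<Sum>l<per n. F ((shift_map ^^ (l + i)) (\<xi> n))) = (\<Sum>l<per n. F ((shift_map ^^ l) (\<xi> n)))"
    by (rule sum_periodic_shift) (simp only: periodic_\<xi>)
  then show ?thesis
    unfolding integral_\<mu>[OF assms] integral_\<mu>[OF window_local_shift[OF assms]]
    by (simp add: add.commute flip: funpow_add comp_apply[of "shift_map ^^ _" "shift_map ^^ _"])
qed

lemma window_local_average:
  assumes "window_local k m (\<lambda>x. x \<in> C)"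
  shows "window_local k (m + L) (\<lambda>x. (\<Sum>i<L. indicat_real C ((shift_map ^^ i) x)) / real L - c)"
proof (rule window_localI)
  fix x y assume xy: "x \<in> Sigma_shift k" "y \<in> Sigma_shift k" "agree (m + L) x y"
  have "indicat_real C ((shift_map ^^ i) x) = indicat_real C ((shift_map ^^ i) y)" if "i < L" for i
    using that agree_mono[OF xy(3), of "m + i"]
    by (intro window_localD[OF window_local_indicator[OF assms]] shift_map_Sigma_shift agree_shift xy) simp
  then show "(\<Sum>i<L. indicat_real C ((shift_map ^^ i) x)) / real L - c
    = (\<Sum>i<L. indicat_real C ((shift_map ^^ i) y)) / real L - c" by simp
qed

text \<open>Stated for an arbitrary \<open>M\<close>, since it serves both the orbit measures
  \<open>\<mu> N\<close> and the limit.\<close>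

lemma integral_deviation_le:
  assumes C: "window_local k m (\<lambda>x. x \<in> C)" "C \<in> sets (Sigma_borel k)"
    and M: "prob_space M" "sets M = sets (Sigma_borel k)"
    and g: "(\<integral>x. real (glue_dist m (per n) (\<xi> n) x) \<partial>M) \<le> real (per n) * err n + 4 * real m"
  shows "(\<integral>x. \<bar>(\<Sum>i<per n. indicator C ((shift_map ^^ i) x)) / real (per n) - measure (\<mu> n) C\<bar> \<partial>M)
    \<le> err n + 4 * real m / real (per n)"
proof -
  interpret prob_space M by fact
  have sp: "space M = Sigma_shift k" using sets_eq_imp_space_eq[OF M(2)] by simp
  note int = window_local_integral(1)[OF _ finite_measure_axioms M(2)]
  have "(\<integral>x. \<bar>(\<Sum>i<per n. indicator C ((shift_map ^^ i) x)) / real (per n) - measure (\<mu> n) C\<bar> \<partial>M)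
      \<le> (\<integral>x. real (glue_dist m (per n) (\<xi> n) x) / real (per n) \<partial>M)"
    using int[OF window_local_average[OF C(1), of "per n"]] int[OF window_local_glue_dist] average_glue_dist[OF C]
    by (intro integral_mono integrable_abs integrable_divide) (simp_all add: sp)
  also have "\<dots> \<le> (real (per n) * err n + 4 * real m) / real (per n)"
    using g by (simp add: divide_right_mono)
  also have "\<dots> = err n + 4 * real m / real (per n)"
    using per_pos[of n] by (simp add: add_divide_distrib)
  finally show ?thesis .
qed

text \<open>\<open>\<mu> N\<close> gives a local function and its shifts the same integral, so
  \<open>measure (\<mu> N) C\<close> is also the \<open>\<mu> N\<close>-mean of the window
  frequencies of length \<open>per n\<close>, and these concentrate near
  \<open>measure (\<mu> n) C\<close>.\<close>

lemma measure_\<mu>_diff_le: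
  assumes C: "window_local k m (\<lambda>x. x \<in> C)" "C \<in> sets (Sigma_borel k)" and "n \<le> N"
  shows "\<bar>measure (\<mu> N) C - measure (\<mu> n) C\<bar> \<le> err n + 4 * real m / real (per n)"
proof -
  interpret prob_space "\<mu> N" by (rule prob_space_\<mu>)
  let ?a = "\<lambda>x. (\<Sum>i<per n. indicat_real C ((shift_map ^^ i) x)) / real (per n) - measure (\<mu> n) C"
  note loc = window_local_indicator[OF C(1)]
  note int = window_local_integral(1)[OF _ finite_measure_axioms sets_orbit_measure]
  have "(\<integral>x. indicat_real C ((shift_map ^^ i) x) \<partial>\<mu> N) = measure (\<mu> N) C" for i
    by (simp only: integral_\<mu>_shift[OF loc] integral_indicator_\<mu>[OF C(2)])
  moreover have i: "integrable (\<mu> N) (\<lambda>x. indicat_real C ((shift_map ^^ i) x))" for i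
    by (rule int[OF window_local_shift[OF loc]])
  moreover have "(\<integral>x. ?a x \<partial>\<mu> N)
      = (\<Sum>i<per n. \<integral>x. indicat_real C ((shift_map ^^ i) x) \<partial>\<mu> N) / real (per n) - measure (\<mu> n) C"
  proof -
    have "(\<integral>x. ?a x \<partial>\<mu> N) = (\<integral>x. (\<Sum>i<per n. indicat_real C ((shift_map ^^ i) x)) / real (per n) \<partial>\<mu> N)
        - (\<integral>x. measure (\<mu> n) C \<partial>\<mu> N)"
      by (intro Bochner_Integration.integral_diff integrable_divide Bochner_Integration.integrable_sum i) simp
    moreover have "(\<integral>x. (\<Sum>i<per n. indicat_real C ((shift_map ^^ i) x)) \<partial>\<mu> N)
      = (\<Sum>i<per n. \<integral>x. indicat_real C ((shift_map ^^ i) x) \<partial>\<mu> N)"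
      by (rule Bochner_Integration.integral_sum) (rule i)
    ultimately show ?thesis by (simp only: integral_divide_zero lebesgue_integral_const prob_space scaleR_one)
  qed
  ultimately have eq: "measure (\<mu> N) C - measure (\<mu> n) C = (\<integral>x. ?a x \<partial>\<mu> N)"
    using per_pos[of n] by simp
  have "\<bar>\<integral>x. ?a x \<partial>\<mu> N\<bar> \<le> (\<integral>x. \<bar>?a x\<bar> \<partial>\<mu> N)" by (rule integral_abs_bound)
  also have "\<dots> \<le> err n + 4 * real m / real (per n)"
    by (rule integral_deviation_le[OF C prob_space_axioms _ integral_glue_dist_le[OF \<open>n \<le> N\<close>]]) simp
  finally show ?thesis unfolding eq .
qed

lemma deviation_tendsto: "(\<lambda>n. err n + 4 * real m / real (per n)) \<longlonglongrightarrow> 0"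
proof -
  have "(\<lambda>n. 4 * real m / real (per n)) \<longlonglongrightarrow> 0"
    by (rule tendsto_divide_0[OF tendsto_const filterlim_at_top_imp_at_infinity[OF per_at_top]])
  from tendsto_add[OF err_tendsto this] show ?thesis by simp
qed

lemma convergent_measure_\<mu>:
  assumes "C \<in> local_sets k"
  shows "convergent (\<lambda>n. measure (\<mu> n) C)"
proof -
  obtain m where m: "window_local k m (\<lambda>x. x \<in> C)" using assms unfolding local_sets_def by blast
  note le = measure_\<mu>_diff_le[OF m local_sets_measurable[OF assms]]
  have "Cauchy (\<lambda>n. measure (\<mu> n) C)"
  proof (rule metric_CauchyI)
    fix e :: real assume "e > 0"
    then have "\<forall>\<^sub>F n in sequentially. err n + 4 * real m / real (per n) < e / 2"
      by (intro order_tendstoD(2)[OF deviation_tendsto]) simp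
    then obtain n where n: "err n + 4 * real m / real (per n) < e / 2"
      using eventually_happens'[OF sequentially_bot] by blast
    have "dist (measure (\<mu> i) C) (measure (\<mu> j) C) < e" if "i \<ge> n" "j \<ge> n" for i j
      using le[OF that(1)] le[OF that(2)] n unfolding dist_real_def by linarith
    then show "\<exists>M. \<forall>i\<ge>M. \<forall>j\<ge>M. dist (measure (\<mu> i) C) (measure (\<mu> j) C) < e" by blast
  qed
  then show ?thesis by (rule Cauchy_convergent)
qed

end

section \<open>Invariance, ergodicity and zero entropy of the limit\<close>

locale repetitive_limit = repetitive_words +
  fixes \<nu> :: "(int \<Rightarrow> nat) measure"
  assumes prob: "prob_space \<nu>" and sets_\<nu>: "sets \<nu> = sets (Sigma_borel k)"
    and lim: "C \<in> local_sets k \<Longrightarrow> (\<lambda>n. measure (\<mu> n) C) \<longlonglongrightarrow> measure \<nu> C"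
begin

sublocale prob_space \<nu> by (rule prob)

lemma space_\<nu>: "space \<nu> = Sigma_shift k"
  using sets_eq_imp_space_eq[OF sets_\<nu>] by simp

lemma weak: "weak_star_converges k \<mu> \<nu>"
  by (rule weak_star_convergesI_local[OF prob_space_\<mu> sets_orbit_measure prob sets_\<nu> lim])

text \<open>On local sets invariance holds exactly for every \<open>\<mu> n\<close>, by periodicity
  of the orbit, and it passes to the limit there; local sets determine the measure.\<close>

lemma invariant: "invariant_measure \<nu> shift_map"
proof -
  have meas: "shift_map \<in> measurable \<nu> \<nu>"
    using shift_map_measurable[of k] sets_\<nu> by (simp cong: measurable_cong_sets)
  have "distr \<nu> \<nu> shift_map = \<nu>"
  proof (rule measure_eq_of_local_sets)
    show "finite_measure (distr \<nu> \<nu> shift_map)"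
      by (rule prob_space.finite_measure[OF prob_space_distr[OF meas]])
    show "sets (distr \<nu> \<nu> shift_map) = sets (Sigma_borel k)" by (simp add: sets_\<nu>)
    fix C assume C: "C \<in> local_sets k"
    then obtain m where m: "window_local k m (\<lambda>x. x \<in> C)" unfolding local_sets_def by blast
    let ?D = "{x \<in> Sigma_shift k. shift_map x \<in> C}"
    have D: "?D \<in> local_sets k"
      using window_local_preimage[OF window_local_shift[OF m, of 1], of "{True}"] by simp
    have CD: "C \<in> sets (Sigma_borel k)" "?D \<in> sets (Sigma_borel k)"
      using local_sets_measurable C D by blast+
    have "measure (\<mu> n) ?D = measure (\<mu> n) C" for n
    proof -
      have "measure (\<mu> n) ?D = (\<integral>x. indicat_real ?D x \<partial>\<mu> n)"
        by (rule integral_indicator_\<mu>[OF CD(2), symmetric])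
      also have "\<dots> = (\<integral>x. indicat_real C ((shift_map ^^ 1) x) \<partial>\<mu> n)"
        by (intro Bochner_Integration.integral_cong refl) (simp add: indicator_def)
      also have "\<dots> = (\<integral>x. indicat_real C x \<partial>\<mu> n)"
        by (rule integral_\<mu>_shift[OF window_local_indicator[OF m]])
      finally show ?thesis by (simp only: integral_indicator_\<mu>[OF CD(1)])
    qed
    then have "measure \<nu> ?D = measure \<nu> C"
      using lim[OF C] lim[OF D] LIMSEQ_unique by simp
    moreover have "shift_map -` C \<inter> space \<nu> = ?D" by (auto simp: space_\<nu>)
    ultimately show "emeasure (distr \<nu> \<nu> shift_map) C = emeasure \<nu> C"
      using meas CD(1) by (simp add: emeasure_distr sets_\<nu> emeasure_eq_measure)
  qed (rule sets_\<nu>)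
  with meas show ?thesis by (simp add: invariant_measure_def)
qed

text \<open>\<open>glue_dist\<close> is local, hence a legitimate test function for weak
  convergence.\<close>

lemma integral_glue_dist_limit_le:
  "(\<integral>x. real (glue_dist m (per n) (\<xi> n) x) \<partial>\<nu>) \<le> real (per n) * err n + 4 * real m"
proof (rule LIMSEQ_le_const2)
  show "(\<lambda>N. \<integral>x. real (glue_dist m (per n) (\<xi> n) x) \<partial>\<mu> N) \<longlonglongrightarrow> (\<integral>x. real (glue_dist m (per n) (\<xi> n) x) \<partial>\<nu>)"
    using weak window_local_continuous_on[OF window_local_glue_dist] unfolding weak_star_converges_def by blast
  show "\<exists>N0. \<forall>N\<ge>N0. (\<integral>x. real (glue_dist m (per n) (\<xi> n) x) \<partial>\<mu> N) \<le> real (per n) * err n + 4 * real m"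
    using integral_glue_dist_le by blast
qed

lemma ergodic_limit: "ergodic \<nu> shift_map"
proof (rule ergodicI_averages[OF prob invariant])
  interpret A: algebra "Sigma_shift k" "local_sets k" by (rule algebra_local_sets)
  show "Int_stable (local_sets k)" by (rule A.Int_stable)
  show "local_sets k \<subseteq> Pow (space \<nu>)" using A.space_closed by (simp add: space_\<nu>)
  show "sets \<nu> = sigma_sets (space \<nu>) (local_sets k)" by (simp add: space_\<nu> sets_\<nu> sets_Sigma_borel)
  fix C and e :: real assume C: "C \<in> local_sets k" and "e > 0"
  then obtain m where m: "window_local k m (\<lambda>x. x \<in> C)" unfolding local_sets_def by blast
  note CM = local_sets_measurable[OF C]
  \<comment> \<open>Averages of length \<open>per n\<close> concentrate near
    \<open>measure (\<mu> n) C\<close>; the second summand pays for recentring at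
    \<open>measure \<nu> C\<close>.\<close>
  have "(\<lambda>n. (err n + 4 * real m / real (per n)) + \<bar>measure (\<mu> n) C - measure \<nu> C\<bar>) \<longlonglongrightarrow> 0 + \<bar>measure \<nu> C - measure \<nu> C\<bar>"
    by (intro tendsto_add deviation_tendsto tendsto_rabs tendsto_diff lim[OF C] tendsto_const)
  then have "\<forall>\<^sub>F n in sequentially. (err n + 4 * real m / real (per n)) + \<bar>measure (\<mu> n) C - measure \<nu> C\<bar> < e"
    using \<open>e > 0\<close> by (intro order_tendstoD(2)) auto
  then obtain n where n: "(err n + 4 * real m / real (per n)) + \<bar>measure (\<mu> n) C - measure \<nu> C\<bar> < e"
    using eventually_happens'[OF sequentially_bot] by blast
  let ?a = "\<lambda>c x. (\<Sum>i<per n. indicat_real C ((shift_map ^^ i) x)) / real (per n) - c"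
  have int: "integrable \<nu> (?a c)" for c
    by (rule window_local_integral(1)[OF window_local_average[OF m] finite_measure_axioms sets_\<nu>])
  have "(\<integral>x. \<bar>?a (measure \<nu> C) x\<bar> \<partial>\<nu>)
      \<le> (\<integral>x. \<bar>?a (measure (\<mu> n) C) x\<bar> + \<bar>measure (\<mu> n) C - measure \<nu> C\<bar> \<partial>\<nu>)"
    by (intro integral_mono integrable_abs int Bochner_Integration.integrable_add integrable_const) linarith
  also have "\<dots> = (\<integral>x. \<bar>?a (measure (\<mu> n) C) x\<bar> \<partial>\<nu>) + \<bar>measure (\<mu> n) C - measure \<nu> C\<bar>"
    using integrable_abs[OF int] by (simp add: prob_space)
  also have "\<dots> \<le> e"
    using integral_deviation_le[OF m CM prob sets_\<nu> integral_glue_dist_limit_le, of n] n by linarith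
  finally show "\<exists>n>0. (\<integral>x. \<bar>(\<Sum>i<n. indicator C ((shift_map ^^ i) x)) / real n - measure \<nu> C\<bar> \<partial>\<nu>) \<le> e"
    using per_pos[of n] by blast
qed

text \<open>The cells of \<open>P\<close> are arbitrary Borel sets, whereas closeness of windows
  only controls local functions. Replacing each cell by a local set costs the exceptional set
  \<open>B\<close>, the union of the symmetric differences.\<close>

lemma approximate_cells:
  assumes P: "measurable_partition \<nu> P" and "\<delta> > 0"
  obtains c :: "(int \<Rightarrow> nat) \<Rightarrow> (int \<Rightarrow> nat) set" and m B where
    "window_local k m c" "B \<in> sets \<nu>" "measure \<nu> B \<le> \<delta>"
    "\<And>x. x \<in> Sigma_shift k \<Longrightarrow> x \<notin> B \<Longrightarrow> cell_of P x = c x"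
proof -
  note P' = P[unfolded measurable_partition_def]
  have alg: "algebra (space \<nu>) (local_sets k)" "sets \<nu> = sigma_sets (space \<nu>) (local_sets k)"
    by (simp_all add: space_\<nu> sets_\<nu> sets_Sigma_borel algebra_local_sets)
  \<comment> \<open>\<open>card P\<close> symmetric differences of this size have total measure at
    most \<open>\<delta>\<close>.\<close>
  let ?d = "\<delta> / (real (card P) + 1)"
  have "?d > 0" using \<open>\<delta> > 0\<close> by (simp add: add_nonneg_pos)
  have "\<exists>C m. C \<in> local_sets k \<and> window_local k m (\<lambda>x. x \<in> C) \<and> measure \<nu> ((A - C) \<union> (C - A)) < ?d"
    if A: "A \<in> P" for A
  proof -
    have "A \<in> sets \<nu>" using A P' by blast
    from approx_by_algebra[OF alg this \<open>?d > 0\<close>]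
    obtain C where "C \<in> local_sets k" "measure \<nu> ((A - C) \<union> (C - A)) < ?d" by blast
    moreover from this obtain m where "window_local k m (\<lambda>x. x \<in> C)" unfolding local_sets_def by blast
    ultimately show ?thesis by blast
  qed
  then obtain C m where C: "\<And>A. A \<in> P \<Longrightarrow> C A \<in> local_sets k"
    "\<And>A. A \<in> P \<Longrightarrow> window_local k (m A) (\<lambda>x. x \<in> C A)"
    "\<And>A. A \<in> P \<Longrightarrow> measure \<nu> ((A - C A) \<union> (C A - A)) < ?d"
    by metis
  define m' where "m' = Max (insert 0 (m ` P))"
  \<comment> \<open>The sets \<open>C A\<close> may overlap or miss \<open>x\<close>, so a choice is
    made; outside \<open>B\<close> exactly one \<open>A\<close> qualifies, the true cell of
    \<open>x\<close>.\<close>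
  define c where "c x = (SOME A. A \<in> P \<and> x \<in> C A)" for x
  define B where "B = (\<Union>A\<in>P. (A - C A) \<union> (C A - A))"
  have S: "(A - C A) \<union> (C A - A) \<in> sets \<nu>" if "A \<in> P" for A
    using that C(1) P' local_sets_measurable sets_\<nu> by blast
  have "window_local k m' c"
  proof (rule window_localI)
    fix x y assume xy: "x \<in> Sigma_shift k" "y \<in> Sigma_shift k" "agree m' x y"
    have "x \<in> C A \<longleftrightarrow> y \<in> C A" if A: "A \<in> P" for A
    proof -
      have "m A \<le> m'" unfolding m'_def using P' A by (intro Max_ge) auto
      from window_localD[OF C(2)[OF A] xy(1,2) agree_mono[OF xy(3) this]] show ?thesis .
    qed
    then have "(\<lambda>A. A \<in> P \<and> x \<in> C A) = (\<lambda>A. A \<in> P \<and> y \<in> C A)" by blast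
    then show "c x = c y" unfolding c_def by (rule arg_cong[where f=Eps])
  qed
  moreover have finP: "finite P" using P' by blast
  then have "B \<in> sets \<nu>" unfolding B_def by (rule sets.finite_UN) (rule S)
  moreover have B_le: "measure \<nu> B \<le> \<delta>"
  proof -
    have "measure \<nu> B \<le> (\<Sum>A\<in>P. measure \<nu> ((A - C A) \<union> (C A - A)))"
      unfolding B_def by (intro finite_measure_subadditive_finite finP image_subsetI S)
    also have "\<dots> \<le> (\<Sum>A\<in>P. ?d)" using C(3) by (intro sum_mono less_imp_le)
    also have "\<dots> \<le> \<delta>" using \<open>\<delta> > 0\<close> by (simp add: field_simps)
    finally show ?thesis .
  qed
  moreover have B_out: "cell_of P x = c x" if "x \<in> Sigma_shift k" "x \<notin> B" for x
  proof -
    have "x \<in> A \<longleftrightarrow> x \<in> C A" if "A \<in> P" for A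
      using \<open>x \<notin> B\<close> that unfolding B_def by blast
    then have "(\<lambda>A. A \<in> P \<and> x \<in> C A) = (\<lambda>A. A \<in> P \<and> x \<in> A)" by blast
    then have c: "c x = (SOME A. A \<in> P \<and> x \<in> A)" unfolding c_def by (rule arg_cong[where f=Eps])
    have cell: "cell_of P x \<in> P" "x \<in> cell_of P x"
      using cell_of_mem[of "space \<nu>" P x] P' \<open>x \<in> Sigma_shift k\<close> by (auto simp: space_\<nu>)
    then have "c x \<in> P \<and> x \<in> c x"
      unfolding c by (intro someI[of "\<lambda>A. A \<in> P \<and> x \<in> A"] conjI)
    then show ?thesis using cell_of_eq[of "space \<nu>" P "c x" x] P' by blast
  qed
  ultimately show ?thesis by (intro that[OF _ _ B_le B_out])
qed

text \<open>At a position that is neither a mismatch nor a visit to \<open>B\<close>, the cell of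
  the orbit equals the letter of the reference word. \<open>D\<close> counts both kinds of
  exception, and each has mean at most \<open>\<delta> / 2\<close> per letter: mismatches by the
  limit bound on \<open>glue_dist\<close>, visits by invariance.\<close>

lemma zero_entropy_partition:
  assumes P: "measurable_partition \<nu> P"
  shows "entropy_wrt_partition \<nu> shift_map P = 0"
proof (rule entropy_wrt_partition_eq_0[OF P invariant])
  fix \<delta> :: real assume "\<delta> > 0"
  then have half: "\<delta> / 2 > 0" by simp
  obtain c m B where
    c: "window_local k m c" and B: "B \<in> sets \<nu>" "measure \<nu> B \<le> \<delta> / 2"
    and cB: "\<And>x. x \<in> Sigma_shift k \<Longrightarrow> x \<notin> B \<Longrightarrow> cell_of P x = c x"
    by (rule approximate_cells[OF P half]) (rule that)
  have "((\<lambda>x :: real. ln ((x + 1) ^ 2) / x) \<longlongrightarrow> 0) at_top" by real_asymp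
  from filterlim_compose[OF this per_at_top]
  have "\<forall>\<^sub>F n in sequentially. ln ((real (per n) + 1) ^ 2) / real (per n) < \<delta>"
    using \<open>\<delta> > 0\<close> by (rule order_tendstoD(2))
  moreover have "\<forall>\<^sub>F n in sequentially. err n + 4 * real m / real (per n) < \<delta> / 2"
    using deviation_tendsto \<open>\<delta> / 2 > 0\<close> by (rule order_tendstoD(2))
  ultimately have "\<forall>\<^sub>F n in sequentially. ln ((real (per n) + 1) ^ 2) / real (per n) < \<delta> \<and>
      err n + 4 * real m / real (per n) < \<delta> / 2"
    by (rule eventually_conj)
  then obtain n where n: "ln ((real (per n) + 1) ^ 2) / real (per n) < \<delta>"
    "err n + 4 * real m / real (per n) < \<delta> / 2"
    using eventually_happens'[OF sequentially_bot] by blast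
  let ?L = "per n"
  have L: "real ?L > 0" using per_pos[of n] by simp
  define ref where "ref = (\<lambda>(a, b) i. c ((shift_map ^^ glue_index ?L a b i) (\<xi> n)))"
  \<comment> \<open>One reference word for each split \<open>(a, b)\<close>. Their number is at most
    \<open>(L + 1)^2\<close>, whose logarithm is negligible against \<open>L\<close>.\<close>
  define Bs where "Bs = ref ` {(a, b). a + b \<le> ?L}"
  define D where "D x = real (glue_dist m ?L (\<xi> n) x) + (\<Sum>i<?L. indicat_real B ((shift_map ^^ i) x))" for x
  note T = invariant_measure_funpow(1)[OF invariant]
  have "finite Bs" unfolding Bs_def using finite_pairs_le by blast
  moreover have "ref (0, 0) \<in> Bs" unfolding Bs_def by (rule imageI) simp
  then have ne: "Bs \<noteq> {}" by blast
  moreover have intB: "integrable \<nu> (\<lambda>x. indicat_real B ((shift_map ^^ i) x))" for i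
    using B(1) measurable_compose[OF T[of i], of "indicat_real B" borel]
    by (intro integrable_const_bound[where B=1]) (auto simp: indicator_def)
  have intg: "integrable \<nu> (\<lambda>x. real (glue_dist m ?L (\<xi> n) x))"
    by (rule window_local_integral(1)[OF window_local_glue_dist finite_measure_axioms sets_\<nu>])
  have "integrable \<nu> D"
    unfolding D_def by (intro Bochner_Integration.integrable_add intg Bochner_Integration.integrable_sum intB)
  moreover have "ln (real (card Bs)) \<le> \<delta> * real ?L"
  proof -
    have "card {(a, b). a + b \<le> ?L} \<le> card ({..?L} \<times> {..?L})"
      by (intro card_mono) auto
    then have "card Bs \<le> (?L + 1) ^ 2"
      unfolding Bs_def using card_image_le[OF finite_pairs_le, of ref ?L] by (simp add: power2_eq_square)
    then have "real (card Bs) \<le> real ((?L + 1) ^ 2)" by (rule of_nat_mono)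
    then have "real (card Bs) \<le> (real ?L + 1) ^ 2" by (simp add: add.commute)
    moreover have "card Bs > 0" using ne \<open>finite Bs\<close> by (simp add: card_gt_0_iff)
    ultimately have "ln (real (card Bs)) \<le> ln ((real ?L + 1) ^ 2)" by (intro ln_mono) simp_all
    also have "\<dots> \<le> \<delta> * real ?L" using n(1) L by (simp add: divide_less_eq)
    finally show ?thesis .
  qed
  moreover have "(\<integral>x. D x \<partial>\<nu>) \<le> \<delta> * real ?L"
  proof -
    have "(\<integral>x. indicat_real B ((shift_map ^^ i) x) \<partial>\<nu>) = measure \<nu> B" for i
    proof -
      have "(\<integral>x. indicat_real B ((shift_map ^^ i) x) \<partial>\<nu>) = (\<integral>x. indicat_real B x \<partial>distr \<nu> \<nu> (shift_map ^^ i))"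
        using B(1) by (intro integral_distr[symmetric] T) simp
      then show ?thesis using B(1) by (simp add: invariant_measure_funpow(2)[OF invariant])
    qed
    moreover have "(\<integral>x. (\<Sum>i<?L. indicat_real B ((shift_map ^^ i) x)) \<partial>\<nu>)
        = (\<Sum>i<?L. \<integral>x. indicat_real B ((shift_map ^^ i) x) \<partial>\<nu>)"
      by (rule Bochner_Integration.integral_sum) (rule intB)
    moreover have "(\<integral>x. D x \<partial>\<nu>) = (\<integral>x. real (glue_dist m ?L (\<xi> n) x) \<partial>\<nu>)
        + (\<integral>x. (\<Sum>i<?L. indicat_real B ((shift_map ^^ i) x)) \<partial>\<nu>)"
      unfolding D_def by (intro Bochner_Integration.integral_add intg Bochner_Integration.integrable_sum intB)
    ultimately have "(\<integral>x. D x \<partial>\<nu>) = (\<integral>x. real (glue_dist m ?L (\<xi> n) x) \<partial>\<nu>) + real ?L * measure \<nu> B"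
      by simp
    also have "\<dots> \<le> (real ?L * err n + 4 * real m) + real ?L * (\<delta> / 2)"
      using B(2) by (intro add_mono integral_glue_dist_limit_le mult_left_mono) simp_all
    also have "real ?L * err n + 4 * real m = real ?L * (err n + 4 * real m / real ?L)"
      using L by (simp add: distrib_left)
    also have "\<dots> + real ?L * (\<delta> / 2) \<le> real ?L * (\<delta> / 2) + real ?L * (\<delta> / 2)"
      using n(2) by (intro add_right_mono mult_left_mono) simp_all
    finally show ?thesis by (simp add: mult.commute)
  qed
  moreover have "\<forall>x\<in>space \<nu>. \<exists>b\<in>Bs. real (card {i. i < ?L \<and> cell_of P ((shift_map ^^ i) x) \<noteq> b i}) \<le> D x"
  proof
    fix x assume "x \<in> space \<nu>"
    then have x: "x \<in> Sigma_shift k" by (simp add: space_\<nu>)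
    obtain a b where ab: "a + b \<le> ?L" "glue_dist m ?L (\<xi> n) x = card (mismatches m ?L (\<xi> n) a b x)"
      by (rule glue_dist_attained)
    let ?M = "mismatches m ?L (\<xi> n) a b x"
    let ?I = "{i. i < ?L \<and> (shift_map ^^ i) x \<in> B}"
    have "{i. i < ?L \<and> cell_of P ((shift_map ^^ i) x) \<noteq> ref (a, b) i} \<subseteq> ?M \<union> ?I"
    proof (rule subsetI, rule ccontr)
      fix i assume i: "i \<in> {i. i < ?L \<and> cell_of P ((shift_map ^^ i) x) \<noteq> ref (a, b) i}" "i \<notin> ?M \<union> ?I"
      then have "agree m ((shift_map ^^ i) x) ((shift_map ^^ glue_index ?L a b i) (\<xi> n))"
        by (simp add: mismatches_def)
      from window_localD[OF c shift_map_Sigma_shift[OF x] shift_map_Sigma_shift[OF \<xi>] this]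
      have "c ((shift_map ^^ i) x) = ref (a, b) i" by (simp add: ref_def)
      moreover have "cell_of P ((shift_map ^^ i) x) = c ((shift_map ^^ i) x)"
        using i by (intro cB shift_map_Sigma_shift[OF x]) simp
      ultimately show False using i(1) by simp
    qed
    moreover have "finite (?M \<union> ?I)"
      by (rule finite_subset[of _ "{..<?L}"]) (auto simp: mismatches_def)
    ultimately have "card {i. i < ?L \<and> cell_of P ((shift_map ^^ i) x) \<noteq> ref (a, b) i} \<le> card (?M \<union> ?I)"
      by (intro card_mono)
    also have "\<dots> \<le> card ?M + card ?I" by (rule card_Un_le)
    finally have "real (card {i. i < ?L \<and> cell_of P ((shift_map ^^ i) x) \<noteq> ref (a, b) i})
        \<le> real (card ?M) + real (card ?I)" by linarith
    also have "real (card ?I) = (\<Sum>i<?L. indicat_real B ((shift_map ^^ i) x))"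
      by (simp add: indicator_def sum.If_cases Int_def lessThan_def)
    finally have "real (card {i. i < ?L \<and> cell_of P ((shift_map ^^ i) x) \<noteq> ref (a, b) i}) \<le> D x"
      by (simp add: D_def ab(2))
    moreover have "ref (a, b) \<in> Bs" unfolding Bs_def using ab(1) by (intro imageI) simp
    ultimately show "\<exists>b\<in>Bs. real (card {i. i < ?L \<and> cell_of P ((shift_map ^^ i) x) \<noteq> b i}) \<le> D x" by blast
  qed
  ultimately show "\<exists>L>0. \<exists>B (D :: (int \<Rightarrow> nat) \<Rightarrow> real). finite B \<and> B \<noteq> {} \<and> integrable \<nu> D \<and>
      ln (real (card B)) \<le> \<delta> * real L \<and> (\<integral>x. D x \<partial>\<nu>) \<le> \<delta> * real L \<and>
      (\<forall>x\<in>space \<nu>. \<exists>b\<in>B. real (card {i. i < L \<and> cell_of P ((shift_map ^^ i) x) \<noteq> b i}) \<le> D x)"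
    using per_pos[of n] by (intro exI[of _ ?L] exI[of _ Bs] exI[of _ D] conjI)
qed

lemma metric_entropy_limit: "metric_entropy \<nu> shift_map = 0"
proof -
  \<comment> \<open>Some partition must exist, since the supremum of the empty set in
    \<open>ereal\<close> is minus infinity instead of 0.\<close>
  have "measurable_partition \<nu> {space \<nu>}"
    using not_empty by (auto simp: measurable_partition_def intro!: partition_onI)
  then have "{P. measurable_partition \<nu> P} \<noteq> {}" by blast
  then show ?thesis
    unfolding metric_entropy_def by (simp add: zero_entropy_partition flip: zero_ereal_def)
qed

end

theorem theorem1:
  fixes k :: nat
    and f :: "nat \<Rightarrow> complex \<Rightarrow> complex"
    and X :: "nat \<Rightarrow> ((int \<Rightarrow> nat) \<times> complex) set"
    and \<xi> :: "nat \<Rightarrow> int \<Rightarrow> nat"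
    and q :: "nat \<Rightarrow> complex"
    and w :: "nat \<Rightarrow> nat list"
  assumes "k \<ge> 1"
    and "\<And>i. i \<in> {1..k} \<Longrightarrow> circle_C1_diffeo (f i)"
    and "\<And>n. (\<xi> n, q n) \<in> Sigma_shift k \<times> circle"
    and "\<And>n. X n = skew_orbit k f (\<xi> n, q n)"
    and "\<And>n. periodic_point (skew_product f) (\<xi> n, q n)"
    and "\<And>n. generated_by (\<xi> n) (w n)"
    and "repetitive_pattern k f q w"
  shows "\<exists>\<nu>. sets \<nu> = sets (Sigma_borel k) \<and> prob_space \<nu> \<and>
           weak_star_converges k (\<lambda>n. orbit_measure k (\<xi> n) (length (w n))) \<nu> \<and>
           invariant_measure \<nu> shift_map \<and> ergodic \<nu> shift_map \<and> metric_entropy \<nu> shift_map = 0"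
proof -
  obtain K R :: "nat \<Rightarrow> nat" and \<alpha> :: "nat \<Rightarrow> nat list" where
    pat: "\<forall>n\<ge>1. K n \<ge> 2 \<and> R n \<ge> 1 \<and> length (\<alpha> n) = R n \<and> set (\<alpha> n) \<subseteq> {1..k} \<and>
        w n = concat (replicate (K n) (w (n - 1))) @ \<alpha> n"
    and summ: "summable (\<lambda>n. real (R (Suc n)) / (real (K (Suc n)) * real (length (w n))))"
    using assms(7) unfolding repetitive_pattern_def by blast
  have pat: "K (Suc n) \<ge> 2" "R (Suc n) \<ge> 1" "length (\<alpha> (Suc n)) = R (Suc n)"
    "w (Suc n) = concat (replicate (K (Suc n)) (w n)) @ \<alpha> (Suc n)" for n
    using pat[rule_format, of "Suc n"] by simp_all
  \<comment> \<open>The pattern attaches \<open>K\<close> and \<open>\<alpha>\<close> to the word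
    they produce, the locale to the word they start from; hence the shift by
    \<open>Suc\<close>.\<close>
  interpret repetitive_words k \<xi> w "\<lambda>n. \<alpha> (Suc n)" "\<lambda>n. K (Suc n)"
  proof
    fix n
    show "\<xi> n \<in> Sigma_shift k" using assms(3)[of n] by simp
    show "generated_by (\<xi> n) (w n)" by (rule assms(6))
    show "w (Suc n) = concat (replicate (K (Suc n)) (w n)) @ \<alpha> (Suc n)" by (rule pat(4))
    show "1 \<le> K (Suc n)" using pat(1)[of n] by simp
    show "\<alpha> (Suc n) \<noteq> []" using pat(2,3)[of n] by force
    show "summable (\<lambda>n. real (length (\<alpha> (Suc n))) / (real (K (Suc n)) * real (length (w n))))"
      using summ by (simp add: pat(3))
  qed
  obtain \<nu> where \<nu>: "prob_space \<nu>" "sets \<nu> = sets (Sigma_borel k)"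
    "\<And>C. C \<in> local_sets k \<Longrightarrow> (\<lambda>n. measure (\<mu> n) C) \<longlonglongrightarrow> measure \<nu> C"
    using limit_measure_exists[OF prob_space_\<mu> sets_orbit_measure convergent_measure_\<mu>] by blast
  interpret repetitive_limit k \<xi> w "\<lambda>n. \<alpha> (Suc n)" "\<lambda>n. K (Suc n)" \<nu>
    by (intro repetitive_limit.intro repetitive_limit_axioms.intro repetitive_words_axioms \<nu>)
  show ?thesis
    using \<nu>(1,2) weak invariant ergodic_limit metric_entropy_limit
    unfolding per_def by (intro exI[of _ \<nu>] conjI)
qed

end
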